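(* Let $\Delta$ be a $1$-dimensional unit-interval simplicial complex on $[n]$, let $\Gamma=\mathrm{Ind}(\Delta)$, and let $G_\Delta$ be the graph on $[n]$ whose edges are the facets of $\Delta$. Then the $a$-invariant of $R_\Gamma$ is equal to $$-\max\{|B|+1: B\text{ is a maximal clique of }\Delta\}.$$ Moreover, $R_\Gamma$ is Gorenstein if and only if the complementary graph $G_\Delta^c$ is unmixed, and in this case $$\omega_{R_\Gamma}=(x_1\cdots x_nt^{\omega(G_\Delta)+1}),$$ where $\omega(G_\Delta)$ is the clique number of $G_\Delta$.
   Context: A $1$-dimensional simplicial complex $\Delta$ on vertex set $[n]$ is a unit-interval simplicial complex if it is pure (all facets have cardinality $2$) and for every facet $\{i<j\}$ the interval $[i,j]=\{i,i+1,\dots,j\}$ is a clique of $\Delta$, where a clique is a subset $C\subseteq[n]$ all of whose $2$-subsets are facets of $\Delta$. $\mathrm{Ind}(\Delta)$ is the simplicial complex of all subsets of $[n]$ containing no facet of $\Delta$. A graph is unmixed if all its minimal vertex covers have the same cardinality. The clique number is the maximum cardinality of a clique. Let $K$ be a field, $S=K[x_1,\dots,x_n]$, $\mathbf{x}_F=\prod_{i\in F}x_i$ ($\mathbf{x}_\emptyset=1$), and $R_\Gamma=K[\mathbf{x}_Ft:F\in\Gamma]\subset S[t]$, standard graded by $\deg(x_1^{a_1}\cdots x_n^{a_n}t^k)=k$. $R_\Gamma$ is a normal Cohen-Macaulay domain. Its canonical module $\omega_{R_\Gamma}$ is identified with the graded ideal of $R_\Gamma$ which is the intersection of all height one monomial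 prime ideals of $R_\Gamma$ (equivalently, the ideal spanned by the monomials of $R_\Gamma$ whose exponent vectors lie in the relative interior of the cone generated by the exponent vectors of the $\mathbf{x}_Ft$, $F\in\Gamma$). The $a$-invariant is $a(R)=-\min\{j:(\omega_R)_j\ne0\}$. *)

theory Defs
  imports
    "HOL-Algebra.Ideal"
    "HOL-Computational_Algebra.Polynomial"
    "HOL-Library.Poly_Mapping"
    "HOL-Library.Extended_Nat"
    "HOL.Hull"
begin

section \<open>Simplicial complexes and graphs\<close>

definition simplicial_complex_on :: "'v set \<Rightarrow> 'v set set \<Rightarrow> bool" where
  "simplicial_complex_on V D \<longleftrightarrow>
     {} \<in> D \<and> (\<forall>F\<in>D. F \<subseteq> V) \<and> (\<forall>v\<in>V. {v} \<in> D) \<and> (\<forall>F\<in>D. \<forall>H. H \<subseteq> F \<longrightarrow> H \<in> D)"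

definition facets :: "'v set set \<Rightarrow> 'v set set" where
  "facets D = {F \<in> D. \<forall>H\<in>D. F \<subseteq> H \<longrightarrow> H = F}"

text \<open>A graph is given by its vertex set \<open>V\<close> and its set \<open>E\<close> of edges, which are 2-subsets of \<open>V\<close>.\<close>

definition is_clique :: "'v set \<Rightarrow> 'v set set \<Rightarrow> 'v set \<Rightarrow> bool" where
  "is_clique V E C \<longleftrightarrow> C \<subseteq> V \<and> (\<forall>e. e \<subseteq> C \<and> card e = 2 \<longrightarrow> e \<in> E)"

definition is_maximal_clique :: "'v set \<Rightarrow> 'v set set \<Rightarrow> 'v set \<Rightarrow> bool" where
  "is_maximal_clique V E C \<longleftrightarrow>
     is_clique V E C \<and> (\<forall>C'. is_clique V E C' \<and> C \<subseteq> C' \<longrightarrow> C' = C)"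

definition clique_number :: "'v set \<Rightarrow> 'v set set \<Rightarrow> nat" where
  "clique_number V E = Max (card ` {C. is_clique V E C})"

definition complement_edges :: "'v set \<Rightarrow> 'v set set \<Rightarrow> 'v set set" where
  "complement_edges V E = {e. e \<subseteq> V \<and> card e = 2 \<and> e \<notin> E}"

definition vertex_cover :: "'v set \<Rightarrow> 'v set set \<Rightarrow> 'v set \<Rightarrow> bool" where
  "vertex_cover V E C \<longleftrightarrow> C \<subseteq> V \<and> (\<forall>e\<in>E. e \<inter> C \<noteq> {})"

definition minimal_vertex_cover :: "'v set \<Rightarrow> 'v set set \<Rightarrow> 'v set \<Rightarrow> bool" where
  "minimal_vertex_cover V E C \<longleftrightarrow>
     vertex_cover V E C \<and> (\<forall>C'. vertex_cover V E C' \<and> C' \<subseteq> C \<longrightarrow> C' = C)"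

definition unmixed :: "'v set \<Rightarrow> 'v set set \<Rightarrow> bool" where
  "unmixed V E \<longleftrightarrow>
     (\<forall>C C'. minimal_vertex_cover V E C \<and> minimal_vertex_cover V E C' \<longrightarrow> card C = card C')"

definition unit_interval_complex :: "nat \<Rightarrow> nat set set \<Rightarrow> bool" where
  "unit_interval_complex n D \<longleftrightarrow>
     simplicial_complex_on {1..n} D \<and>
     (\<forall>F\<in>facets D. card F = 2) \<and>
     (\<forall>i j. i < j \<and> {i, j} \<in> facets D \<longrightarrow> is_clique {1..n} (facets D) {i..j})"

definition Ind :: "nat \<Rightarrow> nat set set \<Rightarrow> nat set set" where
  "Ind n D = {F. F \<subseteq> {1..n} \<and> (\<forall>G\<in>facets D. \<not> G \<subseteq> F)}"


section \<open>The polynomial ring and the toric ring\<close>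

text \<open>
  The type \<open>(nat \<Rightarrow>\<^sub>0 nat) \<Rightarrow>\<^sub>0 'k\<close> is the polynomial ring over \<open>'k\<close> in the variables \<open>x\<^sub>i\<close>, \<open>i :: nat\<close>;
  an exponent vector is a finitely supported map from variables to exponents. Univariate polynomials
  over it, in the variable \<open>t\<close>, then contain \<open>S[t]\<close>. Only the \<open>x\<^sub>i\<close> with \<open>i \<in> {1..n}\<close> occur in the
  toric ring below.
\<close>

type_synonym 'k mpol = "(nat \<Rightarrow>\<^sub>0 nat) \<Rightarrow>\<^sub>0 'k"

definition xset :: "nat set \<Rightarrow> 'k::field mpol" where
  "xset F = (\<Prod>i\<in>F. Poly_Mapping.single (Poly_Mapping.single i 1) 1)"

definition monomials :: "'k::field mpol poly set" where
  "monomials = {Polynomial.monom (Poly_Mapping.single a 1) k | a k. True}"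

definition is_subalgebra :: "'k::field mpol poly set \<Rightarrow> bool" where
  "is_subalgebra A \<longleftrightarrow>
     (\<forall>c. [:Poly_Mapping.single 0 c:] \<in> A) \<and>
     (\<forall>f\<in>A. \<forall>g\<in>A. f + g \<in> A \<and> f * g \<in> A)"

definition toric_ring :: "nat set set \<Rightarrow> 'k::field mpol poly ring" where
  "toric_ring \<Gamma> =
     \<lparr>carrier = is_subalgebra hull {Polynomial.monom (xset F) 1 | F. F \<in> \<Gamma>},
      monoid.mult = (*), one = 1, zero = 0, add = (+)\<rparr>"

text \<open>
  The component of degree \<open>j\<close> for the grading by the exponent of \<open>t\<close>. It is indexed by the integers,
  and is zero for negative \<open>j\<close>, so that shifts can be formed.
\<close>

definition graded_part :: "'k::field mpol poly set \<Rightarrow> int \<Rightarrow> 'k mpol poly set" where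
  "graded_part M j = {f \<in> M. \<forall>k. Polynomial.coeff f k \<noteq> 0 \<longrightarrow> int k = j}"


section \<open>Canonical module, \<open>a\<close>-invariant and the Gorenstein property\<close>

definition height :: "('a, 'b) ring_scheme \<Rightarrow> 'a set \<Rightarrow> enat" where
  "height R P = Sup {enat h | h. \<exists>Q. Q h = P \<and> (\<forall>i\<le>h. primeideal (Q i) R) \<and> (\<forall>i<h. Q i \<subset> Q (Suc i))}"

definition monomial_ideal :: "'k::field mpol poly set \<Rightarrow> 'k mpol poly ring \<Rightarrow> bool" where
  "monomial_ideal I R \<longleftrightarrow> (\<exists>M \<subseteq> monomials \<inter> carrier R. I = Idl\<^bsub>R\<^esub> M)"

definition canonical_ideal :: "'k::field mpol poly ring \<Rightarrow> 'k mpol poly set" where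
  "canonical_ideal R =
     carrier R \<inter> \<Inter>{P. primeideal P R \<and> monomial_ideal P R \<and> height R P = 1}"

definition a_invariant :: "'k::field mpol poly ring \<Rightarrow> int" where
  "a_invariant R = - (LEAST j. graded_part (canonical_ideal R) j \<noteq> {0})"

text \<open>
  \<open>M \<cong> R(a)\<close> as graded \<open>R\<close>-modules, where \<open>M\<close> is a graded ideal of \<open>R\<close>
  and \<open>R(a)\<^sub>j = R\<^sub>j\<^sub>+\<^sub>a\<close>.
\<close>

definition graded_iso_shift :: "'k::field mpol poly ring \<Rightarrow> 'k mpol poly set \<Rightarrow> int \<Rightarrow> bool" where
  "graded_iso_shift R M a \<longleftrightarrow>
     (\<exists>\<phi>. bij_betw \<phi> (carrier R) M \<and>
          (\<forall>f\<in>carrier R. \<forall>g\<in>carrier R. \<phi> (f \<oplus>\<^bsub>R\<^esub> g) = \<phi> f \<oplus>\<^bsub>R\<^esub> \<phi> g) \<and>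
          (\<forall>r\<in>carrier R. \<forall>f\<in>carrier R. \<phi> (r \<otimes>\<^bsub>R\<^esub> f) = r \<otimes>\<^bsub>R\<^esub> \<phi> f) \<and>
          (\<forall>j. \<phi> ` graded_part (carrier R) (j + a) = graded_part M j))"

text \<open>
  A graded Cohen--Macaulay ring with canonical module \<open>\<omega>\<close> is Gorenstein if
  \<open>\<omega>\<close> is isomorphic, as a graded module, to the ring itself up to a shift. For a normal toric ring,
  which is Cohen--Macaulay, the canonical module is the ideal defined above; the predicate is
  meaningful only for such rings.
\<close>

definition gorenstein :: "'k::field mpol poly ring \<Rightarrow> bool" where
  "gorenstein R \<longleftrightarrow> (\<exists>a. graded_iso_shift R (canonical_ideal R) a)"

end

theory Submission
  imports Defs "HOL-Library.Product_Plus"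
begin

text \<open>
  Write \<open>C\<close> for the set of maximal cliques, which are intervals. A monomial \<open>x\<^sup>a t\<^sup>k\<close> lies in the toric
  ring iff every \<open>B \<in> C\<close> satisfies \<open>\<Sum>i\<in>B. a\<^sub>i \<le> k\<close>, since then a stable set meeting all tight cliques can
  be split off. The inequalities \<open>a\<^sub>i \<ge> 0\<close> and \<open>k - \<Sum>i\<in>B. a\<^sub>i \<ge> 0\<close> define facets whose monomial
  primes have height one, and an interior monomial lies in every nonzero monomial prime, so the
  canonical ideal is spanned by the interior monomials. The least possible \<open>t\<close>-degree of these is
  \<open>max |B| + 1\<close>, attained by \<open>x\<^sub>1 \<dots> x\<^sub>n t\<^bsup>max |B| + 1\<^esup>\<close>. This monomial therefore generates the canonical
  ideal if any element does, and it does so iff all maximal cliques have the same size: a smaller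
  clique \<open>B\<close> gives an interior monomial with \<open>k - \<Sum>i\<in>B. a\<^sub>i = 1\<close> that is not a multiple of it. Minimal
  vertex covers of the complementary graph are the complements of maximal cliques.
\<close>

section \<open>Supports of elements of \<open>S[t]\<close>\<close>

text \<open>The pair \<open>(a, k)\<close> stands for x^a t^k, so addition of pairs is
  multiplication of monomials.\<close>

type_synonym expo = "(nat \<Rightarrow>\<^sub>0 nat) \<times> nat"

definition mterm :: "expo \<Rightarrow> 'k::field \<Rightarrow> 'k mpol poly" where
  "mterm p c = Polynomial.monom (Poly_Mapping.single (fst p) c) (snd p)"

definition coef :: "'k::field mpol poly \<Rightarrow> expo \<Rightarrow> 'k" where
  "coef f p = Poly_Mapping.lookup (Polynomial.coeff f (snd p)) (fst p)"

definition supp :: "'k::field mpol poly \<Rightarrow> expo set" where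
  "supp f = {p. coef f p \<noteq> 0}"

text \<open>The \<open>K\<close>-span of the monomials with exponent in \<open>A\<close>. Semigroup
  rings, facet primes and the canonical ideal all take this form, which turns ring theory into
  statements about exponents.\<close>

definition supported :: "expo set \<Rightarrow> 'k::field mpol poly set" where
  "supported A = {f. supp f \<subseteq> A}"

lemma coef_eqI: "(\<And>p. coef f p = coef g p) \<Longrightarrow> f = g"
  by (rule poly_eqI, rule poly_mapping_eqI) (metis coef_def fst_conv snd_conv)

lemma coef_zero [simp]: "coef 0 p = 0"
  and coef_add [simp]: "coef (f + g) p = coef f p + coef g p"
  and coef_uminus [simp]: "coef (- f) p = - coef f p"
  and coef_mterm: "coef (mterm q c) p = (if p = q then c else 0)"
  by (auto simp: coef_def lookup_add mterm_def coeff_monom lookup_single when_def prod_eq_iff)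

lemma coef_sum: "coef (sum f A) p = (\<Sum>x\<in>A. coef (f x) p)"
  by (induction A rule: infinite_finite_induct) auto

lemma finite_supp [simp]: "finite (supp f)"
proof -
  have "supp f \<subseteq> (\<Union>k\<le>Polynomial.degree f. Poly_Mapping.keys (Polynomial.coeff f k) \<times> {k})"
  proof
    fix p assume p: "p \<in> supp f"
    then have "Polynomial.coeff f (snd p) \<noteq> 0"
      by (auto simp: supp_def coef_def)
    then have "snd p \<le> Polynomial.degree f"
      by (rule le_degree)
    with p show "p \<in> (\<Union>k\<le>Polynomial.degree f. Poly_Mapping.keys (Polynomial.coeff f k) \<times> {k})"
      by (cases p) (auto simp: supp_def coef_def in_keys_iff)
  qed
  then show ?thesis
    by (rule finite_subset) auto
qed

lemma supp_zero [simp]: "supp 0 = {}"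
  by (simp add: supp_def)

lemma supp_eq_empty_iff [simp]: "supp f = {} \<longleftrightarrow> f = 0"
  by (auto simp: supp_def intro: coef_eqI)

lemma supp_uminus [simp]: "supp (- f) = supp f"
  by (simp add: supp_def)

lemma supp_add: "supp (f + g) \<subseteq> supp f \<union> supp g"
  by (auto simp: supp_def)

lemma supp_mterm: "supp (mterm p c) = (if c = 0 then {} else {p})"
  by (auto simp: supp_def coef_mterm)

lemma supp_mult: "supp (f * g) \<subseteq> {p + q | p q. p \<in> supp f \<and> q \<in> supp g}"
proof
  fix r assume "r \<in> supp (f * g)"
  then have "Poly_Mapping.lookup (\<Sum>i\<le>snd r. Polynomial.coeff f i * Polynomial.coeff g (snd r - i)) (fst r) \<noteq> 0"
    by (simp add: supp_def coef_def coeff_mult)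
  then obtain i where "i \<in> {..snd r}"
    and "Poly_Mapping.lookup (Polynomial.coeff f i * Polynomial.coeff g (snd r - i)) (fst r) \<noteq> 0"
    unfolding lookup_sum by (rule sum.not_neutral_contains_not_neutral)
  then have "fst r \<in> Poly_Mapping.keys (Polynomial.coeff f i * Polynomial.coeff g (snd r - i))"
    by (simp add: in_keys_iff)
  then obtain a b where "fst r = a + b" "a \<in> Poly_Mapping.keys (Polynomial.coeff f i)"
      "b \<in> Poly_Mapping.keys (Polynomial.coeff g (snd r - i))"
    using keys_mult by blast
  moreover have "i \<le> snd r"
    using \<open>i \<in> {..snd r}\<close> by simp
  ultimately have "r = (a, i) + (b, snd r - i)" "(a, i) \<in> supp f" "(b, snd r - i) \<in> supp g"
    by (auto simp: supp_def coef_def in_keys_iff prod_eq_iff)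
  then show "r \<in> {p + q | p q. p \<in> supp f \<and> q \<in> supp g}"
    by blast
qed

lemma mterm_mult: "mterm p c * mterm q d = mterm (p + q) (c * d)"
  by (simp add: mterm_def mult_monom mult_single)

lemma one_eq_mterm: "1 = mterm 0 1"
  by (simp add: mterm_def monom_0 one_pCons)

lemma supp_one [simp]: "supp 1 = {0}"
  by (simp add: one_eq_mterm supp_mterm)

lemma sum_mterm_coef:
  assumes "finite A" "supp f \<subseteq> A"
  shows "(\<Sum>p\<in>A. mterm p (coef f p)) = f"
  by (rule coef_eqI) (use assms in \<open>auto simp: coef_sum coef_mterm supp_def\<close>)

lemma mterm_eq_zero_iff [simp]: "mterm p c = 0 \<longleftrightarrow> c = 0"
  by (simp add: mterm_def monom_eq_0_iff) (metis keys_eq_empty keys_single insert_not_empty)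

text \<open>Multiplication by a monomial translates exponents injectively, so nothing cancels; for
  general products \<open>supp_mult\<close> gives only an inclusion.\<close>

lemma coef_mterm_mult: "coef (mterm q c * f) (q + p) = c * coef f p"
proof -
  \<comment> \<open>Inserting \<open>p\<close> keeps the relevant exponent in the index set even
    when it is outside the support of \<open>f\<close>.\<close>
  have "coef (mterm q c * f) (q + p) = coef (\<Sum>r\<in>insert p (supp f). mterm (q + r) (c * coef f r)) (q + p)"
    by (subst sum_mterm_coef[of "insert p (supp f)" f, symmetric])
       (auto simp: sum_distrib_left mterm_mult)
  also have "\<dots> = (\<Sum>r\<in>insert p (supp f). if r = p then c * coef f r else 0)"
    unfolding coef_sum coef_mterm by (intro sum.cong) auto
  also have "\<dots> = c * coef f p"
    by (subst sum.delta) auto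
  finally show ?thesis .
qed

text \<open>Division is termwise: choose a translate back for each exponent of \<open>f\<close> and
  sum the resulting terms.\<close>

lemma mterm_dvd:
  assumes "\<And>p. p \<in> supp f \<Longrightarrow> \<exists>r\<in>A. p = q + r"
  obtains g where "f = mterm q 1 * g" "g \<in> supported A"
proof -
  obtain r where r: "\<And>p. p \<in> supp f \<Longrightarrow> r p \<in> A \<and> p = q + r p"
    using assms by metis
  let ?g = "\<Sum>p\<in>supp f. mterm (r p) (coef f p)"
  have "mterm q 1 * ?g = (\<Sum>p\<in>supp f. mterm (q + r p) (coef f p))"
    by (simp add: sum_distrib_left mterm_mult)
  also have "\<dots> = (\<Sum>p\<in>supp f. mterm p (coef f p))"
    by (rule sum.cong) (use r in auto)
  also have "\<dots> = f"
    by (rule sum_mterm_coef) auto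
  finally have "f = mterm q 1 * ?g" ..
  moreover have "coef ?g s = 0" if "s \<notin> A" for s
    using that r by (auto simp: coef_sum coef_mterm intro!: sum.neutral)
  then have "?g \<in> supported A"
    by (auto simp: supported_def supp_def)
  ultimately show ?thesis
    by (rule that)
qed

lemma supported_induct [consumes 1, case_names zero add mterm]:
  assumes "f \<in> supported A" "P 0" "\<And>f g. P f \<Longrightarrow> P g \<Longrightarrow> P (f + g)"
    "\<And>p c. p \<in> A \<Longrightarrow> P (mterm p c)"
  shows "P f"
proof -
  have "P (\<Sum>p\<in>B. mterm p (coef f p))" if "finite B" "B \<subseteq> supp f" for B
    using that
  proof (induction B rule: finite_induct)
    case (insert p B)
    then have "p \<in> A"
      using assms(1) by (auto simp: supported_def)
    with insert show ?case
      by (simp add: assms(3,4))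
  qed (simp add: assms(2))
  from this[of "supp f"] show ?thesis
    by (simp add: sum_mterm_coef)
qed

lemma zero_supported [simp]: "0 \<in> supported A"
  by (simp add: supported_def)

lemma supported_add [intro]: "f \<in> supported A \<Longrightarrow> g \<in> supported A \<Longrightarrow> f + g \<in> supported A"
  using supp_add[of f g] by (auto simp: supported_def)

lemma supported_uminus [intro]: "f \<in> supported A \<Longrightarrow> - f \<in> supported A"
  by (simp add: supported_def)

lemma mterm_supported [simp]: "mterm p c \<in> supported A \<longleftrightarrow> c = 0 \<or> p \<in> A"
  by (simp add: supported_def supp_mterm)

lemma one_supported: "1 \<in> supported A \<longleftrightarrow> 0 \<in> A"
  by (simp add: supported_def)

lemma supported_mult:
  assumes "f \<in> supported A" "g \<in> supported B" "\<And>p q. p \<in> A \<Longrightarrow> q \<in> B \<Longrightarrow> p + q \<in> C"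
  shows "f * g \<in> supported C"
  using supp_mult[of f g] assms by (fastforce simp: supported_def)

lemma supported_split:
  assumes "f \<in> supported A"
  obtains f0 f1 where "f = f0 + f1" "f0 \<in> supported (A \<inter> B)" "f1 \<in> supported (A - B)"
proof -
  have "\<exists>f0 f1. f = f0 + f1 \<and> f0 \<in> supported (A \<inter> B) \<and> f1 \<in> supported (A - B)"
    using assms
  proof (induction rule: supported_induct)
    case zero
    show ?case
      by (rule exI[of _ 0])+ simp
  next
    case (add f g)
    then obtain f0 f1 g0 g1 where "f = f0 + f1" "g = g0 + g1"
      "f0 \<in> supported (A \<inter> B)" "g0 \<in> supported (A \<inter> B)"
      "f1 \<in> supported (A - B)" "g1 \<in> supported (A - B)"
      by blast
    moreover from this have "f + g = (f0 + g0) + (f1 + g1)"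
      by simp
    ultimately show ?case
      by blast
  next
    case (mterm p c)
    show ?case
    proof (cases "p \<in> B")
      case True
      show ?thesis
        by (rule exI[of _ "mterm p c"], rule exI[of _ 0]) (use True mterm in simp)
    next
      case False
      show ?thesis
        by (rule exI[of _ 0], rule exI[of _ "mterm p c"]) (use False mterm in simp)
    qed
  qed
  then show ?thesis
    using that by blast
qed

section \<open>Semigroup rings and facet functionals\<close>

text \<open>The operations are those of the ambient ring, so a comparison with
  \<open>toric_ring\<close> concerns only the carriers.\<close>

definition semigroup_ring :: "expo set \<Rightarrow> 'k::field mpol poly ring" where
  "semigroup_ring H = \<lparr>carrier = supported H, monoid.mult = (*), one = 1, zero = 0, add = (+)\<rparr>"

lemma semigroup_ring_simps [simp]:
  "carrier (semigroup_ring H) = supported H"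
  "f \<otimes>\<^bsub>semigroup_ring H\<^esub> g = f * g"
  "f \<oplus>\<^bsub>semigroup_ring H\<^esub> g = f + g"
  "\<one>\<^bsub>semigroup_ring H\<^esub> = 1"
  "\<zero>\<^bsub>semigroup_ring H\<^esub> = 0"
  by (simp_all add: semigroup_ring_def)


lemma cring_semigroup_ring:
  assumes "0 \<in> H" "\<And>p q. p \<in> H \<Longrightarrow> q \<in> H \<Longrightarrow> p + q \<in> H"
  shows "cring (semigroup_ring H :: 'k::field mpol poly ring)"
proof (rule cringI)
  show "abelian_group (semigroup_ring H :: 'k mpol poly ring)"
  proof (rule abelian_groupI)
    fix f :: "'k mpol poly"
    assume "f \<in> carrier (semigroup_ring H)"
    then show "\<exists>g\<in>carrier (semigroup_ring H). g \<oplus>\<^bsub>semigroup_ring H\<^esub> f = \<zero>\<^bsub>semigroup_ring H\<^esub>"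
      by (intro bexI[of _ "- f"]) auto
  qed (auto simp: algebra_simps)
  show "comm_monoid (semigroup_ring H :: 'k mpol poly ring)"
    by (rule comm_monoidI)
       (use assms in \<open>auto simp: mult.assoc mult.commute one_supported intro: supported_mult[of _ H _ H]\<close>)
qed (auto simp: algebra_simps)

lemma domain_semigroup_ring:
  assumes "0 \<in> H" "\<And>p q. p \<in> H \<Longrightarrow> q \<in> H \<Longrightarrow> p + q \<in> H"
  shows "domain (semigroup_ring H :: 'k::field mpol poly ring)"
  using cring_semigroup_ring[OF assms]
  by (intro domain.intro domain_axioms.intro) auto

text \<open>\<open>L\<close> plays the role of the primitive facet functionals of the cone of
  \<open>H\<close>. Normality enters as \<open>diff_mem\<close>: a difference of elements of
  \<open>H\<close> on which no functional is negative lies in \<open>H\<close>.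
  \<open>value_one\<close> is primitivity, and \<open>facet_interior\<close> gives a point in the
  relative interior of each facet.\<close>

locale normal_semigroup =
  fixes H :: "expo set" and L :: "(expo \<Rightarrow> int) set"
  assumes finite_L: "finite L"
    and zero_mem: "0 \<in> H"
    and add_mem: "p \<in> H \<Longrightarrow> q \<in> H \<Longrightarrow> p + q \<in> H"
    and additive: "\<l> \<in> L \<Longrightarrow> \<l> (p + q) = \<l> p + \<l> q"
    and nonneg: "\<l> \<in> L \<Longrightarrow> p \<in> H \<Longrightarrow> 0 \<le> \<l> p"
    and diff_mem: "p \<in> H \<Longrightarrow> q \<in> H \<Longrightarrow> (\<And>\<l>. \<l> \<in> L \<Longrightarrow> \<l> q \<le> \<l> p) \<Longrightarrow> \<exists>r\<in>H. p = q + r"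
    and value_one: "\<l> \<in> L \<Longrightarrow> \<exists>z\<in>H. \<l> z = 1"
    and facet_interior: "\<l> \<in> L \<Longrightarrow> \<exists>y\<in>H. \<l> y = 0 \<and> (\<forall>\<l>'\<in>L - {\<l>}. 0 < \<l>' y)"
begin

abbreviation (input) R :: "'k::field mpol poly ring" where
  "R \<equiv> semigroup_ring H"

definition facet_prime :: "(expo \<Rightarrow> int) \<Rightarrow> 'k::field mpol poly set" where
  "facet_prime \<l> = supported {p \<in> H. 0 < \<l> p}"

definition interior :: "expo set" where
  "interior = {p \<in> H. \<forall>\<l>\<in>L. 0 < \<l> p}"

definition times :: "nat \<Rightarrow> expo \<Rightarrow> expo" where
  "times N p = ((\<lambda>q. p + q) ^^ N) 0"

lemma add_interior: "p \<in> H \<Longrightarrow> q \<in> interior \<Longrightarrow> p + q \<in> interior"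
  by (simp add: interior_def add_mem additive nonneg add_nonneg_pos)

lemma additive_zero: "\<l> \<in> L \<Longrightarrow> \<l> 0 = 0"
  using additive[of \<l> 0 0] by simp

lemma times_mem: "p \<in> H \<Longrightarrow> times N p \<in> H"
  by (induction N) (auto simp: times_def zero_mem add_mem)

lemma additive_times: "\<l> \<in> L \<Longrightarrow> \<l> (times N p) = int N * \<l> p"
  by (induction N) (auto simp: times_def additive_zero additive algebra_simps)

lemma mterm_power: "mterm p 1 ^ N = mterm (times N p) 1"
  by (induction N) (auto simp: times_def mterm_mult simp flip: one_eq_mterm)

lemma domain_R: "domain (R :: 'k::field mpol poly ring)"
  by (rule domain_semigroup_ring) (simp_all add: zero_mem add_mem)

lemma cring_R: "cring (R :: 'k::field mpol poly ring)"
  by (rule cring_semigroup_ring) (simp_all add: zero_mem add_mem)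

lemma primeideal_power:
  fixes P :: "'k::field mpol poly set"
  assumes P: "primeideal P R" and f: "f \<in> carrier R" and "f ^ N \<in> P"
  shows "f \<in> P"
  using \<open>f ^ N \<in> P\<close>
proof (induction N)
  case 0
  interpret primeideal P "R :: 'k mpol poly ring" by (rule P)
  \<comment> \<open>Exponent zero puts \<open>1\<close> into the ideal; covering this case spares
    the applications a case distinction.\<close>
  from 0 have "P = carrier R"
    using one_imp_carrier by simp
  with f show ?case
    by simp
next
  case (Suc N)
  interpret primeideal P "R :: 'k mpol poly ring" by (rule P)
  have "f ^ N \<in> carrier R"
  proof (induction N)
    case 0
    show ?case using one_closed by simp
  next
    case (Suc N)
    then show ?case using m_closed[OF f] by simp
  qed
  with Suc I_prime[OF f] show ?case
    by auto
qed

lemma ideal_supported: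
  assumes "A \<subseteq> H" "\<And>p q. p \<in> H \<Longrightarrow> q \<in> A \<Longrightarrow> p + q \<in> A"
  shows "ideal (supported A :: 'k::field mpol poly set) R"
proof (rule idealI)
  show "ring (R :: 'k mpol poly ring)"
    by (rule cring.axioms[OF cring_R])
  interpret cring "R :: 'k mpol poly ring"
    by (rule cring_R)
  show "subgroup (supported A :: 'k mpol poly set) (add_monoid R)"
  proof (rule add.subgroupI)
    show "supported A \<subseteq> carrier R"
      using assms(1) by (auto simp: supported_def)
    show "\<ominus>\<^bsub>R\<^esub> f \<in> supported A" if "f \<in> supported A" for f :: "'k mpol poly"
    proof -
      have "f \<in> carrier R"
        using that assms(1) by (auto simp: supported_def)
      \<comment> \<open>The inverse in the ring record is abstract; uniqueness of inverses
        identifies it with the ambient negation.\<close>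
      then have "\<ominus>\<^bsub>R\<^esub> f = - f"
        by (intro minus_equality) auto
      with that show ?thesis
        by auto
    qed
    show "supported A \<noteq> ({} :: 'k mpol poly set)"
      using zero_supported by blast
  qed auto
  fix f g :: "'k mpol poly"
  assume "f \<in> supported A" "g \<in> carrier R"
  then have "g * f \<in> supported A"
    using supported_mult[of g H f A A] assms(2) by simp
  then show "g \<otimes>\<^bsub>R\<^esub> f \<in> supported A" "f \<otimes>\<^bsub>R\<^esub> g \<in> supported A"
    by (simp_all add: mult.commute)
qed

lemma zero_mem_ideal: "ideal I (R :: 'k::field mpol poly ring) \<Longrightarrow> 0 \<in> I"
  using additive_subgroup.zero_closed[OF ideal.axioms(1), of I R] by simp

text \<open>Coefficient one suffices as a test, since the scalars \<open>mterm 0 c\<close> lie in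
  the ring and every element is the finite sum of its terms.\<close>

lemma supported_subset_ideal:
  fixes I :: "'k::field mpol poly set"
  assumes I: "ideal I R" and "A \<subseteq> H" "\<And>p. p \<in> A \<Longrightarrow> mterm p 1 \<in> I"
  shows "supported A \<subseteq> I"
proof
  interpret ideal I "R :: 'k mpol poly ring" by (rule I)
  fix f :: "'k mpol poly" assume "f \<in> supported A"
  then show "f \<in> I"
  proof (induction rule: supported_induct)
    case zero
    show ?case by (rule zero_mem_ideal[OF I])
  next
    case (add f g)
    then show ?case using additive_subgroup.a_closed[OF is_additive_subgroup] by simp
  next
    case (mterm p c)
    have "mterm 0 c \<otimes>\<^bsub>R\<^esub> mterm p 1 \<in> I"
      by (rule I_l_closed) (use mterm assms zero_mem in auto)
    then show ?case
      by (simp add: mterm_mult)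
  qed
qed

lemma monomial_ideal_supported:
  assumes "A \<subseteq> H" "\<And>p q. p \<in> H \<Longrightarrow> q \<in> A \<Longrightarrow> p + q \<in> A"
  shows "monomial_ideal (supported A :: 'k::field mpol poly set) R"
proof -
  interpret cring "R :: 'k mpol poly ring"
    by (rule cring_R)
  let ?M = "(\<lambda>p. mterm p 1 :: 'k mpol poly) ` A"
  have sub: "?M \<subseteq> carrier R"
    using assms(1) by auto
  have "supported A = Idl\<^bsub>R\<^esub> ?M"
  proof (rule antisym)
    have "?M \<subseteq> Idl\<^bsub>R\<^esub> ?M"
      by (rule genideal_self[OF sub])
    then show "supported A \<subseteq> Idl\<^bsub>R\<^esub> ?M"
      by (intro supported_subset_ideal[OF genideal_ideal[OF sub] assms(1)]) blast
    show "Idl\<^bsub>R\<^esub> ?M \<subseteq> supported A"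
    proof (rule genideal_minimal)
      show "ideal (supported A) (R :: 'k mpol poly ring)"
        using assms by (rule ideal_supported)
    qed auto
  qed
  moreover have "?M \<subseteq> monomials"
    unfolding monomials_def mterm_def by blast
  ultimately show ?thesis
    unfolding monomial_ideal_def using sub by (intro exI[of _ ?M]) simp
qed

section \<open>Facet primes and their height\<close>

lemma facet_prime_closed:
  assumes "\<l> \<in> L" "p \<in> H" "q \<in> {p \<in> H. 0 < \<l> p}"
  shows "p + q \<in> {p \<in> H. 0 < \<l> p}"
  using assms nonneg[of \<l> p] by (simp add: add_mem additive)

lemma ideal_facet_prime: "\<l> \<in> L \<Longrightarrow> ideal (facet_prime \<l> :: 'k::field mpol poly set) R"
  unfolding facet_prime_def by (rule ideal_supported) (blast, rule facet_prime_closed)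

text \<open>Modulo the ideal only the terms with \<open>\<l> p = 0\<close> survive. Their exponents
  are closed under addition, so the product of two surviving parts has no term in the ideal. If it
  lies in the ideal it is therefore zero, and the ambient ring has no zero divisors.\<close>

lemma primeideal_facet_prime:
  assumes l: "\<l> \<in> L"
  shows "primeideal (facet_prime \<l> :: 'k::field mpol poly set) R"
proof (rule primeidealI)
  show ideal: "ideal (facet_prime \<l> :: 'k mpol poly set) R"
    using l by (rule ideal_facet_prime)
  show "cring (R :: 'k mpol poly ring)"
    by (rule cring_R)
  have "(1 :: 'k mpol poly) \<notin> facet_prime \<l>"
    using l by (simp add: facet_prime_def supported_def additive_zero)
  moreover have "(1 :: 'k mpol poly) \<in> carrier R"
    by (simp add: supported_def zero_mem)
  ultimately show "carrier R \<noteq> (facet_prime \<l> :: 'k mpol poly set)"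
    by blast
  interpret ideal "facet_prime \<l> :: 'k mpol poly set" R
    by (rule ideal)
  define A where "A = {p \<in> H. 0 < \<l> p}"
  have facet: "H - A = {p \<in> H. \<l> p = 0}"
    using nonneg[OF l] by (force simp: A_def)
  have P: "facet_prime \<l> = supported (H \<inter> A)"
    unfolding facet_prime_def A_def by (simp add: Int_absorb1)
  fix f g :: "'k mpol poly"
  assume f: "f \<in> carrier R" and g: "g \<in> carrier R"
    and fg: "f \<otimes>\<^bsub>R\<^esub> g \<in> facet_prime \<l>"
  obtain f1 f0 where f01: "f = f1 + f0" "f1 \<in> facet_prime \<l>" "f0 \<in> supported (H - A)"
    using f supported_split[of f H A] unfolding P by auto
  obtain g1 g0 where g01: "g = g1 + g0" "g1 \<in> facet_prime \<l>" "g0 \<in> supported (H - A)"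
    using g supported_split[of g H A] unfolding P by auto
  have carr: "f0 \<in> carrier R"
    using f01(3) by (auto simp: supported_def)
  have eq: "f0 * g0 = f * g + (- (f1 * g) + - (f0 * g1))"
    by (simp add: f01(1) g01(1) algebra_simps)
  have "f1 * g \<in> facet_prime \<l>" "f0 * g1 \<in> facet_prime \<l>"
    using I_r_closed[OF f01(2) g] I_l_closed[OF g01(2) carr] by simp_all
  then have "f0 * g0 \<in> supported (H \<inter> A)"
    using fg unfolding P eq by (intro supported_add supported_uminus) simp_all
  moreover have "f0 * g0 \<in> supported (H - A)"
    by (rule supported_mult[OF f01(3) g01(3)]) (use l in \<open>auto simp: facet add_mem additive\<close>)
  ultimately have "supp (f0 * g0) = {}"
    unfolding supported_def by blast
  then have "f0 = 0 \<or> g0 = 0"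
    by simp
  then show "f \<in> facet_prime \<l> \<or> g \<in> facet_prime \<l>"
    using f01 g01 by auto
qed

text \<open>
  The localisation at a facet prime is a discrete valuation ring: after multiplication by a power of
  a monomial \<open>y\<close> from the interior of the facet, every element is a power of a monomial \<open>z\<close> of value
  one times an element outside the prime.
\<close>

lemma facet_prime_minimal:
  fixes Q :: "'k::field mpol poly set"
  assumes l: "\<l> \<in> L" and Q: "primeideal Q R" and sub: "Q \<subseteq> facet_prime \<l>"
    and f: "f \<in> Q" "f \<noteq> 0"
  shows "facet_prime \<l> \<subseteq> Q"
proof -
  interpret primeideal Q "R :: 'k mpol poly ring" by (rule Q)
  obtain z where z: "z \<in> H" "\<l> z = 1"
    using value_one[OF l] by blast
  obtain y where y: "y \<in> H" "\<l> y = 0" "\<And>\<l>'. \<l>' \<in> L \<Longrightarrow> \<l>' \<noteq> \<l> \<Longrightarrow> 0 < \<l>' y"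
    using facet_interior[OF l] by blast
  have supp_f: "supp f \<subseteq> H" "supp f \<noteq> {}"
    using f a_subset by (auto simp: supported_def)
  have yQ: "mterm y 1 \<notin> Q"
    using sub y by (auto simp: facet_prime_def)
  \<comment> \<open>A large multiple of \<open>y\<close> raises every functional other than
    \<open>\<l>\<close> above its value at \<open>q\<close> and leaves \<open>\<l>\<close>
    unchanged, so divisibility by \<open>q\<close> depends on \<open>\<l>\<close> alone.\<close>
  have division: "\<exists>N. \<forall>p\<in>B. \<exists>r\<in>H. times N y + p = q + r"
    if "finite B" "B \<subseteq> H" "q \<in> H" "\<forall>p\<in>B. \<l> q \<le> \<l> p" for B q
  proof -
    \<comment> \<open>All values at \<open>q\<close> are nonnegative, so their sum bounds each of
      them.\<close>
    define N where "N = nat (\<Sum>\<l>'\<in>L. \<l>' q)"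
    have "\<exists>r\<in>H. times N y + p = q + r" if p: "p \<in> B" for p
    proof (rule diff_mem)
      show "times N y + p \<in> H" "q \<in> H"
        using p \<open>B \<subseteq> H\<close> \<open>q \<in> H\<close> y by (auto intro: add_mem times_mem)
      fix \<l>' assume l': "\<l>' \<in> L"
      show "\<l>' q \<le> \<l>' (times N y + p)"
      proof (cases "\<l>' = \<l>")
        case True
        then show ?thesis
          using l that \<open>\<forall>p\<in>B. \<l> q \<le> \<l> p\<close> by (simp add: additive additive_times y)
      next
        case False
        have "\<l>' q \<le> int N"
          unfolding N_def using member_le_sum[OF l', of "\<lambda>l. l q"] nonneg \<open>q \<in> H\<close> finite_L
          by auto
        also have "\<dots> \<le> int N * \<l>' y"
          using y(3)[OF l' False] by (simp add: mult_le_cancel_left1)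
        also have "\<dots> \<le> \<l>' (times N y + p)"
          using l' nonneg[OF l', of p] p \<open>B \<subseteq> H\<close> by (auto simp: additive additive_times)
        finally show ?thesis .
      qed
    qed
    then show ?thesis
      by blast
  qed
  \<comment> \<open>\<open>m\<close> is the order of \<open>f\<close> along the facet, that is, its
    value under the discrete valuation of \<open>\<l>\<close>.\<close>
  define m where "m = nat (Min (\<l> ` supp f))"
  have nonneg_Min: "0 \<le> Min (\<l> ` supp f)"
    using supp_f nonneg[OF l] by auto
  have "times m z \<in> H"
    using z by (intro times_mem)
  moreover have lz: "\<l> (times m z) = Min (\<l> ` supp f)"
    using l z nonneg_Min by (simp add: additive_times m_def)
  ultimately obtain N where N: "\<forall>p\<in>supp f. \<exists>r\<in>H. times N y + p = times m z + r"
    using division[of "supp f" "times m z"] supp_f by auto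
  let ?yN = "mterm (times N y) (1::'k)"
  have "\<exists>r\<in>H. p = times m z + r" if p: "p \<in> supp (?yN * f)" for p
  proof -
    obtain p0 p' where "p = p0 + p'" "p0 \<in> supp ?yN" "p' \<in> supp f"
      using p supp_mult[of ?yN f] by blast
    moreover from this have "p0 = times N y"
      by (simp add: supp_mterm)
    ultimately show ?thesis
      using N by blast
  qed
  then obtain g where g: "?yN * f = mterm (times m z) 1 * g" "g \<in> supported H"
    by (rule mterm_dvd)
  \<comment> \<open>Otherwise every term of the product would have value above the minimum. But the
    term of \<open>f\<close> attaining the minimum survives multiplication by a power of
    \<open>y\<close>, with the same value.\<close>
  have "g \<notin> facet_prime \<l>"
  proof
    assume "g \<in> facet_prime \<l>"
    have "Min (\<l> ` supp f) \<in> \<l> ` supp f"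
      using supp_f(2) by (intro Min_in) auto
    then obtain p where p: "p \<in> supp f" "\<l> p = Min (\<l> ` supp f)"
      by (metis imageE)
    have "mterm (times m z) 1 * g \<in> supported {p. Min (\<l> ` supp f) < \<l> p}"
      by (rule supported_mult[where A = "{times m z}" and B = "{p \<in> H. 0 < \<l> p}"])
         (use \<open>g \<in> facet_prime \<l>\<close> l lz in \<open>auto simp: facet_prime_def additive\<close>)
    moreover have "times N y + p \<in> supp (?yN * f)"
      using p(1) by (simp add: supp_def coef_mterm_mult)
    ultimately have "Min (\<l> ` supp f) < \<l> (times N y + p)"
      unfolding g(1)[symmetric] supported_def by blast
    then show False
      using p(2) l y by (simp add: additive additive_times)
  qed
  then have "g \<notin> Q"
    using sub by blast
  have "?yN * f \<in> Q"
    using I_l_closed[OF f(1), of ?yN] y by (simp add: times_mem)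
  then have "mterm (times m z) 1 * g \<in> Q"
    by (simp add: g)
  then have "mterm (times m z) 1 \<in> Q"
    using I_prime[of "mterm (times m z) 1" g] g(2) \<open>g \<notin> Q\<close> z by (simp add: times_mem)
  then have "mterm z 1 \<in> Q"
    using primeideal_power[OF Q, of "mterm z 1" m] z by (simp add: mterm_power)
  show "facet_prime \<l> \<subseteq> Q"
    unfolding facet_prime_def
  proof (rule supported_subset_ideal[OF is_ideal])
    \<comment> \<open>A power of \<open>y\<close> times \<open>w\<close> is a multiple of
      \<open>z\<close>, hence in \<open>Q\<close>; as \<open>y\<close> is not in \<open>Q\<close>,
      primality leaves \<open>w\<close>.\<close>
    fix w assume w: "w \<in> {p \<in> H. 0 < \<l> p}"
    then obtain N r where r: "r \<in> H" "times N y + w = z + r"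
      using division[of "{w}" z] z by auto
    have "mterm r 1 \<otimes>\<^bsub>R\<^esub> mterm z 1 \<in> Q"
      by (rule I_l_closed) (use \<open>mterm z 1 \<in> Q\<close> r in auto)
    then have "mterm y 1 ^ N * mterm w 1 \<in> Q"
      using r by (simp add: mterm_power mterm_mult add.commute)
    moreover have "mterm y 1 ^ N \<in> carrier R" "mterm w 1 \<in> carrier R"
      using w y by (simp_all add: mterm_power times_mem)
    ultimately have "mterm y 1 ^ N \<in> Q \<or> mterm w 1 \<in> Q"
      using I_prime[of "mterm y 1 ^ N" "mterm w 1"] by simp
    then show "mterm w 1 \<in> Q"
      using primeideal_power[OF Q, of "mterm y 1" N] yQ y by auto
  qed auto
qed

text \<open>Zero and the facet prime form a chain of length one. In a longer chain the last prime
  before the top would be nonzero, so by \<open>facet_prime_minimal\<close> it would already contain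
  the top.\<close>

lemma height_facet_prime:
  assumes l: "\<l> \<in> L"
  shows "height (R :: 'k::field mpol poly ring) (facet_prime \<l>) = 1"
  unfolding height_def
proof (rule antisym)
  let ?P = "facet_prime \<l> :: 'k mpol poly set"
  show "Sup {enat h |h. \<exists>Q. Q h = ?P \<and> (\<forall>i\<le>h. primeideal (Q i) R) \<and> (\<forall>i<h. Q i \<subset> Q (Suc i))} \<le> 1"
  proof (rule Sup_least, clarify)
    fix h and Q :: "nat \<Rightarrow> 'k mpol poly set"
    assume Q: "Q h = ?P" "\<forall>i\<le>h. primeideal (Q i) R" "\<forall>i<h. Q i \<subset> Q (Suc i)"
    show "enat h \<le> 1"
    proof (rule ccontr)
      assume "\<not> enat h \<le> 1"
      then obtain i where h: "h = Suc (Suc i)"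
        by (metis One_nat_def enat_ord_simps(1) not0_implies_Suc not_less_eq_eq one_enat_def zero_le)
      then have chain: "Q i \<subset> Q (Suc i)" "Q (Suc i) \<subset> ?P" "primeideal (Q i) R" "primeideal (Q (Suc i)) R"
        using Q by auto
      have "0 \<in> Q i"
        by (rule zero_mem_ideal[OF primeideal.axioms(1)[OF chain(3)]])
      with chain(1) obtain f where "f \<in> Q (Suc i)" "f \<noteq> 0"
        by blast
      then have "?P \<subseteq> Q (Suc i)"
        using facet_prime_minimal[OF l chain(4)] chain(2) by blast
      with chain(2) show False
        by blast
    qed
  qed
  obtain z where "z \<in> H" "\<l> z = 1"
    using value_one[OF l] by blast
  then have "mterm z 1 \<in> ?P"
    by (simp add: facet_prime_def)
  moreover have "(mterm z 1 :: 'k mpol poly) \<noteq> 0"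
    by simp
  moreover have "0 \<in> ?P"
    by (simp add: facet_prime_def)
  ultimately have "{0} \<subset> ?P"
    by blast
  moreover have "primeideal {0 :: 'k mpol poly} R"
    using domain.zeroprimeideal[OF domain_R] by simp
  ultimately have "\<exists>Q. Q 1 = ?P \<and> (\<forall>i\<le>1. primeideal (Q i) R) \<and> (\<forall>i<1. Q i \<subset> Q (Suc i))"
    using primeideal_facet_prime[OF l]
    by (intro exI[of _ "\<lambda>i::nat. if i = 0 then {0} else ?P"]) auto
  then show "1 \<le> Sup {enat h |h. \<exists>Q. Q h = ?P \<and> (\<forall>i\<le>h. primeideal (Q i) R) \<and> (\<forall>i<h. Q i \<subset> Q (Suc i))}"
    by (intro Sup_upper) (auto simp: one_enat_def)
qed

section \<open>The canonical ideal as the span of the interior monomials\<close>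

text \<open>A nonzero monomial ideal contains a monomial \<open>w\<close>. A large multiple of
  \<open>u\<close> dominates \<open>w\<close> on every functional, so a power of the monomial of
  \<open>u\<close> is divisible by that of \<open>w\<close>; primality removes the power.\<close>

lemma interior_mem_monomial_prime:
  fixes P :: "'k::field mpol poly set"
  assumes P: "primeideal P R" and mon: "monomial_ideal P R" and "P \<noteq> {0}" and u: "u \<in> interior"
  shows "mterm u 1 \<in> P"
proof -
  interpret primeideal P "R :: 'k mpol poly ring" by (rule P)
  obtain M where M: "M \<subseteq> monomials \<inter> carrier R" "P = Idl\<^bsub>R\<^esub> M"
    using mon unfolding monomial_ideal_def by blast
  have "M \<subseteq> P"
    using M genideal_self by auto
  have "\<not> M \<subseteq> {0}"
  proof
    assume "M \<subseteq> {0}"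
    then have "Idl\<^bsub>R\<^esub> M \<subseteq> {0}"
      using genideal_minimal[OF zeroideal] by simp
    then show False
      using \<open>P = Idl\<^bsub>R\<^esub> M\<close> \<open>P \<noteq> {0}\<close> zero_mem_ideal[OF primeideal.axioms(1)[OF P]] by blast
  qed
  then obtain f where f: "f \<in> M" "f \<noteq> 0"
    by blast
  then obtain a k where "f = Polynomial.monom (Poly_Mapping.single a 1) k"
    using M by (auto simp: monomials_def)
  then have fw: "f = mterm (a, k) 1"
    by (simp add: mterm_def)
  define w where "w = (a, k)"
  have w: "mterm w 1 \<in> P" "w \<in> H"
    using f M \<open>M \<subseteq> P\<close> fw by (auto simp: w_def)
  define N where "N = nat (\<Sum>\<l>\<in>L. \<l> w)"
  have uH: "u \<in> H"
    using u by (simp add: interior_def)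
  have "\<exists>r\<in>H. times N u = w + r"
  proof (rule diff_mem)
    fix \<l> assume l: "\<l> \<in> L"
    have "\<l> w \<le> int N"
      unfolding N_def using member_le_sum[OF l, of "\<lambda>l. l w"] nonneg w finite_L by auto
    also have "\<dots> \<le> int N * \<l> u"
      using u l by (force simp: mult_le_cancel_left1 interior_def)
    finally show "\<l> w \<le> \<l> (times N u)"
      using l by (simp add: additive_times)
  qed (use uH w in \<open>auto intro: times_mem\<close>)
  then obtain r where r: "r \<in> H" "times N u = w + r"
    by blast
  have "mterm w 1 \<otimes>\<^bsub>R\<^esub> mterm r 1 \<in> P"
    by (rule I_r_closed) (use w r in auto)
  then have "mterm u 1 ^ N \<in> P"
    by (simp add: mterm_power mterm_mult r)
  then show ?thesis
    using primeideal_power[OF P] uH by simp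
qed

text \<open>Facet primes are among the intersected primes, which bounds the intersection from above.
  Every other height one monomial prime is nonzero and contains all interior monomials, so no
  classification of these primes is required.\<close>

lemma canonical_ideal_eq: "canonical_ideal (R :: 'k::field mpol poly ring) = supported interior"
proof (rule antisym)
  show "canonical_ideal R \<subseteq> (supported interior :: 'k mpol poly set)"
  proof
    fix f :: "'k mpol poly" assume f: "f \<in> canonical_ideal R"
    then have "f \<in> supported H"
      by (simp add: canonical_ideal_def)
    moreover have "f \<in> facet_prime \<l>" if "\<l> \<in> L" for \<l>
    proof -
      have "monomial_ideal (facet_prime \<l> :: 'k mpol poly set) R"
        unfolding facet_prime_def
        by (rule monomial_ideal_supported) (blast, rule facet_prime_closed[OF that])
      then show ?thesis
        using f primeideal_facet_prime[OF that] height_facet_prime[OF that]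
        unfolding canonical_ideal_def by blast
    qed
    ultimately show "f \<in> supported interior"
      by (fastforce simp: supported_def facet_prime_def interior_def)
  qed
  show "supported interior \<subseteq> canonical_ideal (R :: 'k mpol poly ring)"
    unfolding canonical_ideal_def
  proof (intro Int_greatest Inter_greatest)
    show "supported interior \<subseteq> carrier (R :: 'k mpol poly ring)"
      by (auto simp: supported_def interior_def)
    fix P :: "'k mpol poly set"
    assume "P \<in> {P. primeideal P R \<and> monomial_ideal P R \<and> height R P = 1}"
    then have P: "primeideal P R" "monomial_ideal P R" "height R P = 1"
      by auto
    have "P \<noteq> {0}"
    proof
      assume "P = {0}"
      \<comment> \<open>No prime lies strictly below the zero ideal, because every ideal contains
        zero.\<close>
      have "enat h \<le> 0" if Q: "Q h = P" "\<forall>i\<le>h. primeideal (Q i) R" "\<forall>i<h. Q i \<subset> Q (Suc i)"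
        for h and Q :: "nat \<Rightarrow> 'k mpol poly set"
      proof (cases h)
        case (Suc i)
        have "primeideal (Q i) R"
          using Q Suc by simp
        then have "0 \<in> Q i"
          by (rule zero_mem_ideal[OF primeideal.axioms(1)])
        moreover have "Q i \<subset> {0}"
          using Q Suc \<open>P = {0}\<close> by auto
        ultimately show ?thesis
          by auto
      qed (simp add: zero_enat_def)
      then have "height R P \<le> 0"
        unfolding height_def by (intro Sup_least) blast
      with P show False
        by simp
    qed
    then show "supported interior \<subseteq> P"
      using interior_mem_monomial_prime[OF P(1,2)] primeideal.axioms(1)[OF P(1)]
      by (intro supported_subset_ideal) (auto simp: interior_def)
  qed
qed

end


section \<open>Semigroups cut out by clique inequalities\<close>

text \<open>With constant value one this is the exponent vector of \<open>xset A\<close>.\<close>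

definition vec :: "nat set \<Rightarrow> (nat \<Rightarrow> nat) \<Rightarrow> (nat \<Rightarrow>\<^sub>0 nat)" where
  "vec A f = (\<Sum>i\<in>A. Poly_Mapping.single i (f i))"

definition coord :: "nat \<Rightarrow> expo \<Rightarrow> int" where
  "coord i p = int (Poly_Mapping.lookup (fst p) i)"

text \<open>Integer-valued, so that it is additive on all of \<open>expo\<close> and may be negative
  off the semigroup.\<close>

definition slack :: "nat set \<Rightarrow> expo \<Rightarrow> int" where
  "slack B p = int (snd p) - (\<Sum>i\<in>B. int (Poly_Mapping.lookup (fst p) i))"

definition clique_semigroup :: "nat set \<Rightarrow> nat set set \<Rightarrow> expo set" where
  "clique_semigroup V C =
     {p. Poly_Mapping.keys (fst p) \<subseteq> V \<and> (\<forall>B\<in>C. (\<Sum>i\<in>B. Poly_Mapping.lookup (fst p) i) \<le> snd p)}"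

lemma lookup_vec: "finite A \<Longrightarrow> Poly_Mapping.lookup (vec A f) i = (if i \<in> A then f i else 0)"
  by (simp add: vec_def lookup_sum lookup_single when_def)

lemma keys_vec_subset: "finite A \<Longrightarrow> Poly_Mapping.keys (vec A f) \<subseteq> A"
  by (auto simp: in_keys_iff lookup_vec split: if_splits)

lemma sum_lookup_vec:
  assumes "finite A" "B \<subseteq> A"
  shows "(\<Sum>i\<in>B. Poly_Mapping.lookup (vec A f) i) = sum f B"
  by (rule sum.cong) (use assms in \<open>auto simp: lookup_vec\<close>)

lemma sum_lookup_vec_if:
  assumes "finite A" "B' \<subseteq> A"
  shows "(\<Sum>i\<in>B'. Poly_Mapping.lookup (vec A (\<lambda>i. 1 + (if i \<in> B then M else 0))) i) =
    card B' + M * card (B' \<inter> B)"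
proof -
  have "finite B'"
    using assms finite_subset by blast
  then have "(\<Sum>i\<in>B'. if i \<in> B then M else 0) = M * card (B' \<inter> B)"
    by (simp add: sum.If_cases)
  then show ?thesis
    using assms by (simp only: sum_lookup_vec sum.distrib) simp
qed

lemma slack_nonneg_iff: "0 \<le> slack B p \<longleftrightarrow> (\<Sum>i\<in>B. Poly_Mapping.lookup (fst p) i) \<le> snd p"
  and slack_pos_iff: "0 < slack B p \<longleftrightarrow> (\<Sum>i\<in>B. Poly_Mapping.lookup (fst p) i) < snd p"
  by (simp_all add: slack_def flip: of_nat_sum)

lemma coord_add: "coord i (p + q) = coord i p + coord i q"
  by (simp add: coord_def lookup_add)

lemma slack_add: "slack B (p + q) = slack B p + slack B q"
  by (simp add: slack_def lookup_add sum.distrib)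

text \<open>Covering bounds every exponent by the degree; the antichain condition makes each clique
  inequality define a facet of its own.\<close>

locale clique_family =
  fixes V :: "nat set" and C :: "nat set set"
  assumes finite_V: "finite V"
    and cover: "\<Union>C = V"
    and nonempty: "C \<noteq> {}"
    and antichain: "B \<in> C \<Longrightarrow> B' \<in> C \<Longrightarrow> B \<subseteq> B' \<Longrightarrow> B = B'"
begin

abbreviation H :: "expo set" where
  "H \<equiv> clique_semigroup V C"

abbreviation L :: "(expo \<Rightarrow> int) set" where
  "L \<equiv> coord ` V \<union> slack ` C"

definition max_size :: nat where
  "max_size = Max (card ` C)"

text \<open>The degree exceeds the weight on \<open>B\<close> by exactly \<open>k\<close>. With
  \<open>k = 0\<close> this is a point inside the facet of \<open>slack B\<close>, with
  \<open>k = 1\<close> an interior element of slack one at \<open>B\<close>.\<close>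

definition bump :: "nat set \<Rightarrow> nat \<Rightarrow> expo" where
  "bump B k = (vec V (\<lambda>i. 1 + (if i \<in> B then card V else 0)), card B + card V * card B + k)"

definition all_ones :: expo where
  "all_ones = (vec V (\<lambda>_. 1), max_size + 1)"

lemma subset_V: "B \<in> C \<Longrightarrow> B \<subseteq> V"
  using cover by blast

lemma finite_B: "B \<in> C \<Longrightarrow> finite B"
  using subset_V finite_V finite_subset by blast

lemma finite_C: "finite C"
  using cover finite_V finite_UnionD by blast

lemma card_le_max_size: "B \<in> C \<Longrightarrow> card B \<le> max_size"
  unfolding max_size_def using finite_C by (intro Max_ge) auto

lemma max_size_attained: "\<exists>B\<in>C. card B = max_size"
proof -
  have "max_size \<in> card ` C"
    unfolding max_size_def using finite_C nonempty by (intro Max_in) auto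
  then show ?thesis
    by auto
qed

text \<open>The multiplicity \<open>card V\<close> on \<open>B\<close> outweighs everything that another clique may contain.\<close>

lemma slack_bump:
  assumes B: "B \<in> C" and B': "B' \<in> C"
  shows "slack B' (bump B k) > int k \<or> B' = B \<and> slack B' (bump B k) = int k"
proof -
  have sum: "(\<Sum>i\<in>B'. Poly_Mapping.lookup (fst (bump B k)) i) = card B' + card V * card (B' \<inter> B)"
    using sum_lookup_vec_if[OF finite_V subset_V[OF B']] by (simp add: bump_def)
  show ?thesis
  proof (cases "B' = B")
    case True
    then show ?thesis
      using sum by (simp add: slack_def bump_def flip: of_nat_sum)
  next
    case False
    then have "B' \<inter> B \<subset> B"
      using antichain[OF B B'] by blast
    then have lt: "card (B' \<inter> B) < card B"
      using finite_B[OF B] by (rule psubset_card_mono[rotated])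
    then have "card V * Suc (card (B' \<inter> B)) \<le> card V * card B"
      by (intro mult_le_mono) auto
    moreover have "card B' \<le> card V"
      using finite_V subset_V[OF B'] by (rule card_mono)
    \<comment> \<open>The two bounds absorb \<open>card B'\<close> into one more copy of
      \<open>card V\<close>; strictness comes from the summand \<open>card B\<close>, positive by
      \<open>lt\<close>.\<close>
    ultimately have "card B' + card V * card (B' \<inter> B) + k < snd (bump B k)"
      using lt by (simp add: bump_def)
    then have "int (card B' + card V * card (B' \<inter> B)) + int k < int (snd (bump B k))"
      by linarith
    then show ?thesis
      unfolding slack_def using sum by (simp flip: of_nat_sum)
  qed
qed

lemma bump_mem: "B \<in> C \<Longrightarrow> bump B k \<in> H"
  unfolding clique_semigroup_def
proof (intro CollectI conjI ballI)
  show "Poly_Mapping.keys (fst (bump B k)) \<subseteq> V"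
    using finite_V by (simp add: bump_def keys_vec_subset)
  fix B' assume "B \<in> C" "B' \<in> C"
  then have "0 \<le> slack B' (bump B k)"
    using slack_bump[of B B' k] by auto
  then show "(\<Sum>i\<in>B'. Poly_Mapping.lookup (fst (bump B k)) i) \<le> snd (bump B k)"
    by (simp only: slack_nonneg_iff)
qed

lemma coord_bump: "i \<in> V \<Longrightarrow> 0 < coord i (bump B k)"
  using finite_V by (simp add: bump_def coord_def lookup_vec)

text \<open>The witness is the componentwise difference. Natural subtraction is exact: exponents
  compare through the \<open>coord\<close> functionals and vanish outside \<open>V\<close>, and
  degrees compare because the degree is slack plus weight on any clique.\<close>

lemma diff_mem_clique:
  assumes p: "p \<in> H" and q: "q \<in> H" and le: "\<And>\<l>. \<l> \<in> L \<Longrightarrow> \<l> q \<le> \<l> p"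
  shows "\<exists>r\<in>H. p = q + r"
proof -
  have fst_le: "Poly_Mapping.lookup (fst q) i \<le> Poly_Mapping.lookup (fst p) i" for i
  proof (cases "i \<in> V")
    case True
    then show ?thesis
      using le[of "coord i"] by (simp add: coord_def)
  next
    case False
    then have "Poly_Mapping.lookup (fst q) i = 0"
      using q by (auto simp: clique_semigroup_def in_keys_iff)
    then show ?thesis
      by simp
  qed
  have slack_le: "slack B q \<le> slack B p" if "B \<in> C" for B
    using le that by blast
  obtain B where B: "B \<in> C"
    using nonempty by blast
  have "(\<Sum>i\<in>B. int (Poly_Mapping.lookup (fst q) i)) \<le> (\<Sum>i\<in>B. int (Poly_Mapping.lookup (fst p) i))"
    using fst_le by (intro sum_mono) simp
  then have snd_le: "snd q \<le> snd p"
    using slack_le[OF B] by (simp add: slack_def)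
  define r where "r = (fst p - fst q, snd p - snd q)"
  have "fst p = fst q + (fst p - fst q)"
    by (rule poly_mapping_eqI) (simp add: lookup_add lookup_minus fst_le)
  then have r: "p = q + r"
    using snd_le by (simp add: r_def prod_eq_iff)
  have "Poly_Mapping.keys (fst r) \<subseteq> V"
    using p by (auto simp: r_def clique_semigroup_def in_keys_iff lookup_minus)
  moreover have "0 \<le> slack B r" if "B \<in> C" for B
    using slack_le[OF that] by (simp add: r slack_add)
  ultimately have "r \<in> H"
    by (simp add: clique_semigroup_def slack_nonneg_iff)
  with r show ?thesis
    by blast
qed

lemma unit_vector_mem:
  assumes "i \<in> V"
  shows "(vec {i} (\<lambda>_. 1), 1) \<in> H"
proof -
  have "(\<Sum>j\<in>B. Poly_Mapping.lookup (vec {i} (\<lambda>_. 1)) j) \<le> 1" if "B \<in> C" for B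
    using finite_B[OF that] by (simp add: lookup_vec sum.If_cases card_le_Suc0_iff_eq)
  then show ?thesis
    using assms keys_vec_subset[of "{i}" "\<lambda>_. 1"] by (auto simp: clique_semigroup_def)
qed

sublocale normal_semigroup H L
proof
  show "finite L"
    using finite_V finite_C by simp
  show "0 \<in> H"
    by (simp add: clique_semigroup_def)
  show "p + q \<in> H" if "p \<in> H" "q \<in> H" for p q
  proof -
    have "Poly_Mapping.keys (fst (p + q)) \<subseteq> V"
      using that keys_add[of "fst p" "fst q"] by (auto simp: clique_semigroup_def)
    moreover have "0 \<le> slack B (p + q)" if "B \<in> C" for B
      using \<open>p \<in> H\<close> \<open>q \<in> H\<close> that unfolding slack_add
      by (intro add_nonneg_nonneg) (auto simp: clique_semigroup_def slack_nonneg_iff)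
    ultimately show ?thesis
      by (simp only: clique_semigroup_def slack_nonneg_iff mem_Collect_eq) blast
  qed
  fix \<l> assume l: "\<l> \<in> L"
  show "\<l> (p + q) = \<l> p + \<l> q" for p q
    using l by (elim UnE imageE) (simp_all only: coord_add slack_add)
  show "0 \<le> \<l> p" if "p \<in> H" for p
    using l that by (auto simp: clique_semigroup_def slack_nonneg_iff coord_def)
  show "\<exists>z\<in>H. \<l> z = 1"
    using l
  proof (elim UnE imageE)
    fix i assume "\<l> = coord i" "i \<in> V"
    then show ?thesis
      using unit_vector_mem by (intro bexI[of _ "(vec {i} (\<lambda>_. 1), 1)"]) (auto simp: coord_def lookup_vec)
  next
    \<comment> \<open>The monomial t has slack one at every clique.\<close>
    fix B assume "\<l> = slack B" "B \<in> C"
    then show ?thesis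
      by (intro bexI[of _ "(0, 1)"]) (auto simp: slack_def clique_semigroup_def)
  qed
  show "\<exists>y\<in>H. \<l> y = 0 \<and> (\<forall>\<l>'\<in>L - {\<l>}. 0 < \<l>' y)"
    using l
  proof (elim UnE imageE)
    fix i assume i: "\<l> = coord i" "i \<in> V"
    \<comment> \<open>Only the exponent at \<open>i\<close> is zero, and degree
      \<open>card V + 1\<close> exceeds the weight on any clique.\<close>
    define y where "y = (vec V (\<lambda>j. if j = i then 0 else 1), card V + 1)"
    have slack: "0 < slack B y" if "B \<in> C" for B
    proof -
      have "(\<Sum>j\<in>B. Poly_Mapping.lookup (fst y) j) = (\<Sum>j\<in>B. if j = i then 0 else 1)"
        unfolding y_def fst_conv by (rule sum_lookup_vec[OF finite_V subset_V[OF that]])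
      also have "\<dots> \<le> (\<Sum>j\<in>B. 1)"
        by (intro sum_mono) auto
      also have "\<dots> \<le> card V"
        using card_mono[OF finite_V subset_V[OF that]] by simp
      finally show ?thesis
        by (simp add: slack_pos_iff y_def)
    qed
    have "y \<in> H"
      using slack keys_vec_subset[OF finite_V] less_imp_le
      by (fastforce simp: clique_semigroup_def slack_pos_iff y_def)
    moreover have "\<l> y = 0"
      using i finite_V by (simp add: coord_def y_def lookup_vec)
    moreover have "\<forall>\<l>'\<in>L - {\<l>}. 0 < \<l>' y"
      using slack i finite_V by (auto simp: coord_def y_def lookup_vec split: if_splits)
    ultimately show ?thesis
      by blast
  next
    fix B assume B: "\<l> = slack B" "B \<in> C"
    have "\<l> (bump B 0) = 0"
      using slack_bump[OF B(2) B(2), of 0] sum_lookup_vec_if[OF finite_V subset_V[OF B(2)]]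
      by (simp add: B slack_def bump_def flip: of_nat_sum)
    \<comment> \<open>\<open>L\<close> is a set of functionals, so the other slacks are those
      different as functions; their cliques differ from \<open>B\<close> and
      \<open>slack_bump\<close> applies.\<close>
    moreover have "0 < slack B' (bump B 0)" if "B' \<in> C" "slack B' \<noteq> slack B" for B'
      using slack_bump[OF B(2) that(1), of 0] that(2) by auto
    ultimately show ?thesis
      using B bump_mem coord_bump by (intro bexI[of _ "bump B 0"]) auto
  qed
qed (rule diff_mem_clique)

section \<open>Interior elements and the a-invariant\<close>

lemma mem_interior_iff:
  "p \<in> interior \<longleftrightarrow> p \<in> H \<and> (\<forall>i\<in>V. 0 < coord i p) \<and> (\<forall>B\<in>C. 0 < slack B p)"
  by (auto simp: interior_def)

lemma bump_interior: "B \<in> C \<Longrightarrow> bump B 1 \<in> interior"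
  using slack_bump[of B _ 1] by (force simp: mem_interior_iff bump_mem coord_bump)

lemma slack_all_ones: "B \<in> C \<Longrightarrow> slack B all_ones = int (max_size + 1) - int (card B)"
  using sum_lookup_vec[OF finite_V subset_V, of B "\<lambda>_. 1"]
  by (simp add: slack_def all_ones_def flip: of_nat_sum)

lemma all_ones_interior: "all_ones \<in> interior"
proof -
  have "0 < slack B all_ones" if "B \<in> C" for B
    using slack_all_ones[OF that] card_le_max_size[OF that] by simp
  moreover from this have "all_ones \<in> H"
    using keys_vec_subset[OF finite_V, of "\<lambda>_. 1"]
    by (auto simp: clique_semigroup_def all_ones_def slack_pos_iff less_imp_le)
  moreover have "0 < coord i all_ones" if "i \<in> V" for i
    using that finite_V by (simp add: coord_def all_ones_def lookup_vec)
  ultimately show ?thesis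
    by (simp add: mem_interior_iff)
qed

text \<open>All exponents are positive, so a largest clique has weight at least its size, and
  positive slack adds one more.\<close>

lemma interior_degree:
  assumes "p \<in> interior"
  shows "max_size + 1 \<le> snd p"
proof -
  obtain B where B: "B \<in> C" "card B = max_size"
    using max_size_attained by blast
  have "card B \<le> (\<Sum>i\<in>B. Poly_Mapping.lookup (fst p) i)"
    unfolding card_eq_sum using assms subset_V[OF B(1)]
    by (intro sum_mono) (fastforce simp: mem_interior_iff coord_def)
  also have "\<dots> < snd p"
    using assms B by (simp add: mem_interior_iff slack_pos_iff)
  finally show ?thesis
    using B by simp
qed

text \<open>\<open>all_ones\<close> attains the lower bound of \<open>interior_degree\<close>.
  Exhibiting the minimum also settles that \<open>LEAST\<close> is meaningful over the
  integers.\<close>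

lemma a_invariant_R: "a_invariant (R :: 'k::field mpol poly ring) = - int (max_size + 1)"
proof -
  let ?M = "supported interior :: 'k mpol poly set"
  have "(LEAST j. graded_part ?M j \<noteq> {0}) = int (max_size + 1)"
  proof (rule Least_equality)
    have "mterm all_ones 1 \<in> ?M"
      using all_ones_interior by simp
    then have "mterm all_ones 1 \<in> graded_part ?M (int (max_size + 1))"
      by (simp add: graded_part_def mterm_def coeff_monom all_ones_def)
    moreover have "(mterm all_ones 1 :: 'k mpol poly) \<noteq> 0"
      by simp
    ultimately show "graded_part ?M (int (max_size + 1)) \<noteq> {0}"
      by blast
  next
    fix j assume ne: "graded_part ?M j \<noteq> {0}"
    have "0 \<in> graded_part ?M j"
      by (simp add: graded_part_def)
    with ne obtain f where f: "f \<in> graded_part ?M j" "f \<noteq> 0"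
      by blast
    then obtain p where p: "p \<in> supp f"
      using supp_eq_empty_iff by blast
    then have "Polynomial.coeff f (snd p) \<noteq> 0"
      by (auto simp: supp_def coef_def)
    then have "int (snd p) = j"
      using f(1) by (simp add: graded_part_def)
    moreover have "p \<in> interior"
      using f(1) p by (auto simp: graded_part_def supported_def)
    ultimately show "int (max_size + 1) \<le> j"
      using interior_degree[of p] by simp
  qed
  then show ?thesis
    by (simp add: a_invariant_def canonical_ideal_eq)
qed

section \<open>The Gorenstein property and principality of the canonical ideal\<close>

text \<open>Each vertex lies in some clique, whose inequality forces its exponent to vanish in
  degree zero. The degree zero part of the ring is thus \<open>K\<close>.\<close>

lemma constant_mterm:
  assumes "f \<in> supported H" "Polynomial.degree f = 0"
  obtains c where "f = mterm 0 c"
proof -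
  have "p = 0" if p: "p \<in> supp f" for p
  proof -
    have "Polynomial.coeff f (snd p) \<noteq> 0"
      using p by (auto simp: supp_def coef_def)
    then have snd: "snd p = 0"
      using assms(2) le_degree by fastforce
    have pH: "p \<in> H"
      using assms(1) p by (auto simp: supported_def)
    have "Poly_Mapping.lookup (fst p) i = 0" for i
    proof (cases "i \<in> V")
      case True
      then obtain B where B: "B \<in> C" "i \<in> B"
        using cover by blast
      then have "(\<Sum>i\<in>B. Poly_Mapping.lookup (fst p) i) \<le> 0"
        using pH snd by (auto simp: clique_semigroup_def)
      then show ?thesis
        using B finite_B by simp
    next
      case False
      then show ?thesis
        using pH by (auto simp: clique_semigroup_def in_keys_iff)
    qed
    then have "fst p = 0"
      by (intro poly_mapping_eqI) simp
    with snd show "p = 0"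
      by (simp add: prod_eq_iff)
  qed
  then have "f = (\<Sum>p\<in>{0}. mterm p (coef f p))"
    by (intro sum_mterm_coef[symmetric]) auto
  then show ?thesis
    using that by simp
qed

lemma degree_supported_interior:
  assumes "f \<in> supported interior" "f \<noteq> 0"
  shows "max_size + 1 \<le> Polynomial.degree f"
proof -
  have "Poly_Mapping.keys (Polynomial.coeff f (Polynomial.degree f)) \<noteq> {}"
    using assms(2) by simp
  then obtain a where "a \<in> Poly_Mapping.keys (Polynomial.coeff f (Polynomial.degree f))"
    by blast
  then have "(a, Polynomial.degree f) \<in> supp f"
    by (simp add: supp_def coef_def in_keys_iff)
  then show ?thesis
    using assms(1) interior_degree[of "(a, Polynomial.degree f)"] by (auto simp: supported_def)
qed

text \<open>By linearity the image \<open>u\<close> of \<open>1\<close> generates. The monomial of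
  \<open>all_ones\<close>, having the least possible degree, can then only be a scalar multiple of
  \<open>u\<close>, so it generates as well.\<close>

lemma gorenstein_imp_principal:
  assumes "gorenstein (R :: 'k::field mpol poly ring)"
  shows "canonical_ideal (R :: 'k mpol poly ring) = Idl\<^bsub>R\<^esub> {mterm all_ones 1}"
proof -
  interpret cring "R :: 'k mpol poly ring"
    by (rule cring_R)
  let ?v = "mterm all_ones (1 :: 'k)"
  let ?M = "supported interior :: 'k mpol poly set"
  have sub: "{?v} \<subseteq> carrier R"
    using all_ones_interior by (simp add: interior_def)
  obtain \<phi> where \<phi>: "bij_betw \<phi> (carrier R) ?M"
    and lin: "\<And>r f. r \<in> carrier R \<Longrightarrow> f \<in> carrier R \<Longrightarrow> \<phi> (r \<otimes>\<^bsub>R\<^esub> f) = r \<otimes>\<^bsub>R\<^esub> \<phi> f"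
    using assms unfolding gorenstein_def graded_iso_shift_def canonical_ideal_eq by blast
  define u where "u = \<phi> 1"
  have one: "1 \<in> carrier (R :: 'k mpol poly ring)"
    using one_closed by simp
  have gen: "\<exists>f\<in>supported H. g = f * u" if g: "g \<in> ?M" for g
  proof -
    obtain f where f: "f \<in> carrier R" "g = \<phi> f"
      using \<phi> g unfolding bij_betw_def by blast
    then have "g = f * u"
      using lin[OF f(1) one] by (simp add: u_def)
    with f(1) show ?thesis
      by (intro bexI[of _ f]) simp_all
  qed
  have uM: "u \<in> ?M"
    using \<phi> one unfolding bij_betw_def u_def by blast
  have vM: "?v \<in> ?M"
    using all_ones_interior by simp
  obtain f where f: "f \<in> supported H" "?v = f * u"
    using gen[OF vM] by blast
  have "f * u \<noteq> 0"
    unfolding f(2)[symmetric] by simp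
  then have nz: "f \<noteq> 0" "u \<noteq> 0"
    by auto
  \<comment> \<open>Degrees in t add up, and \<open>u\<close> already has degree at least
    \<open>max_size + 1\<close>; nothing is left for the cofactor \<open>f\<close>.\<close>
  have "Polynomial.degree ?v = max_size + 1"
    by (simp add: mterm_def degree_monom_eq all_ones_def keys_eq_empty[symmetric])
  then have "Polynomial.degree f + Polynomial.degree u = max_size + 1"
    using nz unfolding f(2) by (simp add: degree_mult_eq)
  then have "Polynomial.degree f = 0"
    using degree_supported_interior[OF uM nz(2)] by simp
  then obtain c where c: "f = mterm 0 c"
    using constant_mterm[OF f(1)] by blast
  have "c \<noteq> 0"
    using nz c by auto
  have "mterm 0 (1 / c) * ?v = mterm 0 1 * u"
    unfolding f(2) c mult.assoc[symmetric] mterm_mult using \<open>c \<noteq> 0\<close> by simp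
  then have u: "u = mterm 0 (1 / c) * ?v"
    by (simp flip: one_eq_mterm)
  have vI: "?v \<in> Idl\<^bsub>R\<^esub> {?v}"
    using genideal_self[OF sub] by simp
  have "?M \<subseteq> Idl\<^bsub>R\<^esub> {?v}"
  proof
    fix g assume "g \<in> ?M"
    then obtain h where h: "h \<in> supported H" "g = h * u"
      using gen by blast
    have "mterm 0 (1 / c) \<otimes>\<^bsub>R\<^esub> ?v \<in> Idl\<^bsub>R\<^esub> {?v}"
      by (rule ideal.I_l_closed[OF genideal_ideal[OF sub] vI]) (simp add: zero_mem)
    then have "u \<in> Idl\<^bsub>R\<^esub> {?v}"
      by (simp add: u)
    then have "h \<otimes>\<^bsub>R\<^esub> u \<in> Idl\<^bsub>R\<^esub> {?v}"
      by (rule ideal.I_l_closed[OF genideal_ideal[OF sub]]) (simp add: h)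
    then show "g \<in> Idl\<^bsub>R\<^esub> {?v}"
      by (simp add: h)
  qed
  moreover have "Idl\<^bsub>R\<^esub> {?v} \<subseteq> ?M"
  proof (rule genideal_minimal)
    show "ideal ?M R"
    proof (rule ideal_supported)
      show "interior \<subseteq> H"
        by (auto simp: interior_def)
    qed (rule add_interior)
  qed (use vM in simp)
  ultimately show ?thesis
    by (simp add: canonical_ideal_eq)
qed

text \<open>The interior element \<open>bump B 1\<close> has slack one at \<open>B\<close>. Being a
  multiple of the generator, it forces \<open>all_ones\<close> to have slack at most one there,
  which means that \<open>B\<close> is as large as possible.\<close>

lemma principal_imp_card_eq:
  assumes "canonical_ideal (R :: 'k::field mpol poly ring) = Idl\<^bsub>R\<^esub> {mterm all_ones 1}"
    and B: "B \<in> C"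
  shows "card B = max_size"
proof -
  interpret cring "R :: 'k mpol poly ring"
    by (rule cring_R)
  let ?v = "mterm all_ones (1 :: 'k)"
  have "?v \<in> carrier R"
    using all_ones_interior by (simp add: interior_def)
  then have "Idl\<^bsub>R\<^esub> {?v} = PIdl\<^bsub>R\<^esub> ?v"
    by (rule cgenideal_eq_genideal[symmetric])
  moreover have "mterm (bump B 1) 1 \<in> canonical_ideal (R :: 'k mpol poly ring)"
    using bump_interior[OF B] by (simp add: canonical_ideal_eq)
  ultimately obtain f where f: "f \<in> supported H" "mterm (bump B 1) 1 = f * ?v"
    using assms(1) unfolding cgenideal_def by auto
  have "bump B 1 \<in> supp (f * ?v)"
    unfolding f(2)[symmetric] by (simp add: supp_mterm)
  then obtain r s where rs: "bump B 1 = r + s" "r \<in> supp f" "s \<in> supp ?v"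
    using supp_mult[of f ?v] by blast
  then have "s = all_ones" "r \<in> H"
    using f(1) by (auto simp: supp_mterm supported_def)
  then have "slack B all_ones \<le> slack B (bump B 1)"
    using rs(1) nonneg[of "slack B" r] B by (simp add: slack_add)
  also have "slack B (bump B 1) = 1"
    using sum_lookup_vec_if[OF finite_V subset_V[OF B]]
    by (simp add: slack_def bump_def flip: of_nat_sum)
  finally show ?thesis
    using slack_all_ones[OF B] card_le_max_size[OF B] by simp
qed

text \<open>When all sizes agree, every functional is one at \<open>all_ones\<close>, the least
  positive value. Hence the interior is \<open>all_ones\<close> plus \<open>H\<close>, and
  multiplication by this monomial is the required isomorphism.\<close>

lemma card_eq_imp_gorenstein:
  assumes "\<And>B. B \<in> C \<Longrightarrow> card B = max_size"
  shows "gorenstein (R :: 'k::field mpol poly ring)"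
  unfolding gorenstein_def graded_iso_shift_def canonical_ideal_eq
proof (intro exI conjI ballI allI)
  let ?v = "mterm all_ones (1 :: 'k)"
  let ?M = "supported interior :: 'k mpol poly set"
  let ?\<phi> = "\<lambda>f. ?v * f"
  have into: "?v * f \<in> ?M" if "f \<in> supported H" for f
  proof (rule supported_mult)
    show "?v \<in> supported {all_ones}"
      by simp
    show "p + q \<in> interior" if "p \<in> {all_ones}" "q \<in> H" for p q
      using that add_interior[OF _ all_ones_interior] by (simp add: add.commute)
  qed (rule that)
  have onto: "\<exists>g\<in>supported H. f = ?v * g" if f: "f \<in> ?M" for f
  proof -
    have "\<exists>r\<in>H. p = all_ones + r" if "p \<in> supp f" for p
    proof (rule diff_mem)
      have p: "p \<in> interior"
        using f that by (auto simp: supported_def)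
      then show "p \<in> H" "all_ones \<in> H"
        using all_ones_interior by (simp_all add: interior_def)
      fix \<l> assume l: "\<l> \<in> L"
      have "\<l> all_ones = 1"
        using l
      proof (elim UnE imageE)
        fix i assume "\<l> = coord i" "i \<in> V"
        then show ?thesis
          using finite_V by (simp add: coord_def all_ones_def lookup_vec)
      next
        fix B assume "\<l> = slack B" "B \<in> C"
        then show ?thesis
          using slack_all_ones assms by simp
      qed
      moreover have "0 < \<l> p"
        using p l by (simp only: interior_def) blast
      ultimately show "\<l> all_ones \<le> \<l> p"
        by simp
    qed
    then obtain g where "f = ?v * g" "g \<in> supported H"
      by (rule mterm_dvd)
    then show ?thesis
      by blast
  qed
  have image: "?\<phi> ` supported H = ?M"
    using into onto by blast
  have "inj_on ?\<phi> (supported H)"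
    by (rule inj_onI) simp
  then show "bij_betw ?\<phi> (carrier R) ?M"
    using image by (simp add: bij_betw_def)
  show "?\<phi> (f \<oplus>\<^bsub>R\<^esub> g) = ?\<phi> f \<oplus>\<^bsub>R\<^esub> ?\<phi> g" for f g
    by (simp add: algebra_simps)
  show "?\<phi> (f \<otimes>\<^bsub>R\<^esub> g) = f \<otimes>\<^bsub>R\<^esub> ?\<phi> g" for f g
    by (simp add: algebra_simps)
  define c where "c = (Poly_Mapping.single (fst all_ones) 1 :: 'k mpol)"
  have "c \<noteq> 0"
    unfolding c_def keys_eq_empty[symmetric] by simp
  have coeff: "Polynomial.coeff (?v * f) k =
      (if k < max_size + 1 then 0 else c * Polynomial.coeff f (k - (max_size + 1)))" for f k
    unfolding mterm_def coeff_monom_mult by (simp add: c_def all_ones_def)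
  \<comment> \<open>Multiplication raises the t-degree by \<open>max_size + 1\<close>; the truncated
    subtraction in \<open>coeff\<close> is used only above that bound, where it is exact.\<close>
  have graded: "(\<forall>k. Polynomial.coeff (?v * f) k \<noteq> 0 \<longrightarrow> int k = j) \<longleftrightarrow>
      (\<forall>k. Polynomial.coeff f k \<noteq> 0 \<longrightarrow> int k = j + - int (max_size + 1))" (is "?l \<longleftrightarrow> ?r")
    for f j
  proof
    assume l: ?l
    show ?r
    proof (intro allI impI)
      fix k assume "Polynomial.coeff f k \<noteq> 0"
      then have "Polynomial.coeff (?v * f) (k + (max_size + 1)) \<noteq> 0"
        using \<open>c \<noteq> 0\<close> unfolding coeff by simp
      then have "int (k + (max_size + 1)) = j"
        using l by blast
      then show "int k = j + - int (max_size + 1)"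
        by simp
    qed
  next
    assume r: ?r
    show ?l
    proof (intro allI impI)
      fix k assume "Polynomial.coeff (?v * f) k \<noteq> 0"
      then have "\<not> k < max_size + 1" "Polynomial.coeff f (k - (max_size + 1)) \<noteq> 0"
        unfolding coeff by (auto split: if_splits)
      moreover from this have "int (k - (max_size + 1)) = j + - int (max_size + 1)"
        using r by blast
      ultimately show "int k = j"
        by (simp add: of_nat_diff)
    qed
  qed
  \<comment> \<open>This fixes the existentially quantified shift as the a-invariant.\<close>
  show "?\<phi> ` graded_part (carrier R) (j + - int (max_size + 1)) = graded_part ?M j" for j
  proof (rule antisym)
    show "?\<phi> ` graded_part (carrier R) (j + - int (max_size + 1)) \<subseteq> graded_part ?M j"
      using into graded by (auto simp: graded_part_def)
    show "graded_part ?M j \<subseteq> ?\<phi> ` graded_part (carrier R) (j + - int (max_size + 1))"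
    proof
      fix f assume f: "f \<in> graded_part ?M j"
      then obtain g where g: "g \<in> supported H" "f = ?v * g"
        using onto by (auto simp: graded_part_def)
      then have "g \<in> graded_part (carrier R) (j + - int (max_size + 1))"
        using f graded[of g j] by (simp add: graded_part_def)
      with g show "f \<in> ?\<phi> ` graded_part (carrier R) (j + - int (max_size + 1))"
        by blast
    qed
  qed
qed

lemma gorenstein_iff: "gorenstein (R :: 'k::field mpol poly ring) \<longleftrightarrow> (\<forall>B\<in>C. card B = max_size)"
  using gorenstein_imp_principal principal_imp_card_eq card_eq_imp_gorenstein by metis

end


section \<open>Cliques and vertex covers\<close>

lemma finite_cliques: "finite V \<Longrightarrow> finite {C. is_clique V E C}"
  by (rule finite_subset[of _ "Pow V"]) (auto simp: is_clique_def)

lemma clique_extends_to_maximal: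
  assumes "finite V" "is_clique V E C"
  obtains B where "is_maximal_clique V E B" "C \<subseteq> B"
proof -
  obtain B where "is_clique V E B" "C \<subseteq> B" "\<forall>B'\<in>{C. is_clique V E C}. B \<subseteq> B' \<longrightarrow> B = B'"
    using finite_has_maximal2[OF finite_cliques[OF assms(1)], of C E] assms(2) by auto
  then show ?thesis
    using that unfolding is_maximal_clique_def by blast
qed

lemma is_clique_singleton: "v \<in> V \<Longrightarrow> is_clique V E {v}"
  unfolding is_clique_def by (auto simp: subset_singleton_iff)

text \<open>Singletons are cliques, so isolated vertices are covered too; extending the empty clique
  gives a member even when \<open>V\<close> is empty.\<close>

lemma clique_family_maximal_cliques:
  assumes "finite V"
  shows "clique_family V {B. is_maximal_clique V E B}"
proof
  show "finite V"
    by fact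
  show "\<Union>{B. is_maximal_clique V E B} = V"
  proof (rule antisym)
    show "\<Union>{B. is_maximal_clique V E B} \<subseteq> V"
      by (auto simp: is_maximal_clique_def is_clique_def)
    show "V \<subseteq> \<Union>{B. is_maximal_clique V E B}"
    proof
      fix v assume "v \<in> V"
      then obtain B where "is_maximal_clique V E B" "{v} \<subseteq> B"
        using clique_extends_to_maximal[OF assms is_clique_singleton] by metis
      then show "v \<in> \<Union>{B. is_maximal_clique V E B}"
        by blast
    qed
  qed
  have "is_clique V E {}"
    by (simp add: is_clique_def)
  then show "{B. is_maximal_clique V E B} \<noteq> {}"
    using clique_extends_to_maximal[OF assms] by blast
  show "B = B'" if "B \<in> {B. is_maximal_clique V E B}" "B' \<in> {B. is_maximal_clique V E B}" "B \<subseteq> B'" for B B'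
    using that by (auto simp: is_maximal_clique_def)
qed

text \<open>Every clique extends to a maximal one of at least the same size.\<close>

lemma clique_number_eq_Max:
  fixes V :: "nat set"
  assumes "finite V"
  shows "clique_number V E = Max (card ` {B. is_maximal_clique V E B})"
  unfolding clique_number_def
proof (rule Max_eqI)
  have fin: "finite {B. is_maximal_clique V E B}"
    by (rule finite_subset[OF _ finite_cliques[OF assms, of E]]) (auto simp: is_maximal_clique_def)
  show "finite (card ` {C. is_clique V E C})"
    using finite_cliques[OF assms] by simp
  show "c \<le> Max (card ` {B. is_maximal_clique V E B})" if c: "c \<in> card ` {C. is_clique V E C}" for c
  proof -
    obtain C where C: "is_clique V E C" "c = card C"
      using c by blast
    obtain B where B: "is_maximal_clique V E B" "C \<subseteq> B"
      using clique_extends_to_maximal[OF assms C(1)] .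
    have "finite B"
      using B(1) assms finite_subset by (auto simp: is_maximal_clique_def is_clique_def)
    then have "c \<le> card B"
      using B(2) C(2) card_mono by blast
    also have "\<dots> \<le> Max (card ` {B. is_maximal_clique V E B})"
      using fin B(1) by (intro Max_ge) auto
    finally show ?thesis .
  qed
  have "Max (card ` {B. is_maximal_clique V E B}) \<in> card ` {B. is_maximal_clique V E B}"
    using fin clique_family.nonempty[OF clique_family_maximal_cliques[OF assms]] by (intro Max_in) auto
  then show "Max (card ` {B. is_maximal_clique V E B}) \<in> card ` {C. is_clique V E C}"
    by (auto simp: is_maximal_clique_def)
qed

lemma vertex_cover_complement_edges:
  "vertex_cover V (complement_edges V E) W \<longleftrightarrow> W \<subseteq> V \<and> is_clique V E (V - W)"
  unfolding vertex_cover_def complement_edges_def is_clique_def by blast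

text \<open>Complementation in \<open>V\<close> reverses inclusion and exchanges vertex covers of
  the complementary graph with cliques.\<close>

lemma minimal_vertex_cover_complement_edges:
  "minimal_vertex_cover V (complement_edges V E) W \<longleftrightarrow> W \<subseteq> V \<and> is_maximal_clique V E (V - W)"
proof
  assume W: "minimal_vertex_cover V (complement_edges V E) W"
  have "C' = V - W" if "is_clique V E C'" "V - W \<subseteq> C'" for C'
  proof -
    have "C' \<subseteq> V"
      using that by (simp add: is_clique_def)
    then have "V - (V - C') = C'"
      by blast
    then have "V - C' = W"
      using W that unfolding minimal_vertex_cover_def vertex_cover_complement_edges
      by (metis Diff_subset Diff_subset_conv Un_commute)
    with \<open>C' \<subseteq> V\<close> show ?thesis
      by blast
  qed
  with W show "W \<subseteq> V \<and> is_maximal_clique V E (V - W)"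
    unfolding minimal_vertex_cover_def vertex_cover_complement_edges is_maximal_clique_def by blast
next
  assume W: "W \<subseteq> V \<and> is_maximal_clique V E (V - W)"
  have "W' = W" if "W' \<subseteq> V" "is_clique V E (V - W')" "W' \<subseteq> W" for W'
  proof -
    have "V - W' = V - W"
      using W that unfolding is_maximal_clique_def by blast
    with W that show ?thesis
      by blast
  qed
  with W show "minimal_vertex_cover V (complement_edges V E) W"
    unfolding minimal_vertex_cover_def vertex_cover_complement_edges is_maximal_clique_def by blast
qed

text \<open>The sizes of a cover and of its complementary clique add up to \<open>card V\<close>, so
  constancy of one is constancy of the other.\<close>

lemma unmixed_complement_edges_iff:
  assumes "finite V"
  shows "unmixed V (complement_edges V E) \<longleftrightarrow>
    (\<forall>B B'. is_maximal_clique V E B \<and> is_maximal_clique V E B' \<longrightarrow> card B = card B')"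
proof
  assume unmixed: "unmixed V (complement_edges V E)"
  show "\<forall>B B'. is_maximal_clique V E B \<and> is_maximal_clique V E B' \<longrightarrow> card B = card B'"
  proof (intro allI impI, elim conjE)
    fix B B' assume B: "is_maximal_clique V E B" and B': "is_maximal_clique V E B'"
    have sub: "B \<subseteq> V" "B' \<subseteq> V"
      using B B' by (auto simp: is_maximal_clique_def is_clique_def)
    then have "V - (V - B) = B" "V - (V - B') = B'"
      by auto
    then have "card (V - B) = card (V - B')"
      using unmixed B B' unfolding unmixed_def minimal_vertex_cover_complement_edges by simp
    then show "card B = card B'"
      using sub assms card_mono[OF assms sub(1)] card_mono[OF assms sub(2)]
      by (simp add: card_Diff_subset finite_subset)
  qed
next
  assume eq: "\<forall>B B'. is_maximal_clique V E B \<and> is_maximal_clique V E B' \<longrightarrow> card B = card B'"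
  show "unmixed V (complement_edges V E)"
    unfolding unmixed_def minimal_vertex_cover_complement_edges
  proof (intro allI impI, elim conjE)
    fix W W' assume W: "W \<subseteq> V" "W' \<subseteq> V"
      and "is_maximal_clique V E (V - W)" "is_maximal_clique V E (V - W')"
    then have "card (V - W) = card (V - W')"
      using eq by blast
    then show "card W = card W'"
      using W assms card_mono[OF assms W(1)] card_mono[OF assms W(2)]
      by (simp add: card_Diff_subset finite_subset)
  qed
qed

section \<open>The toric ring as a semigroup ring\<close>

lemma monom_xset:
  assumes "finite F"
  shows "Polynomial.monom (xset F) k = mterm (vec F (\<lambda>_. 1), k) 1"
proof -
  have "xset F = Poly_Mapping.single (vec F (\<lambda>_. 1)) 1"
    using assms by (induction F rule: finite_induct) (simp_all add: xset_def vec_def mult_single)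
  then show ?thesis
    by (simp add: mterm_def)
qed

text \<open>A discrete intermediate value argument; it locates the vertex whose block of list
  positions contains position \<open>t\<close>.\<close>

lemma prefix_sum_hit:
  fixes s :: "nat \<Rightarrow> nat"
  assumes "s v \<le> t" "t < s (Suc w)" "v \<le> w"
  shows "\<exists>j\<in>{v..w}. s j \<le> t \<and> t < s (Suc j)"
  using assms(3,2)
proof (induction w rule: dec_induct)
  case base
  then show ?case
    using assms(1) by auto
next
  case (step w)
  show ?case
  proof (cases "t < s (Suc w)")
    case True
    then show ?thesis
      using step.IH by fastforce
  next
    case False
    then show ?thesis
      using step by (intro bexI[of _ "Suc w"]) auto
  qed
qed

section \<open>Splitting off stable sets in unit-interval graphs\<close>

locale unit_interval_graph =
  fixes n :: nat and E :: "nat set set"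
  assumes interval_clique: "i < j \<Longrightarrow> {i, j} \<in> E \<Longrightarrow> is_clique {1..n} E {i..j}"
begin

sublocale clique_family "{1..n}" "{B. is_maximal_clique {1..n} E B}"
  by (rule clique_family_maximal_cliques) simp

text \<open>The extreme vertices of \<open>B\<close> are adjacent, so the interval between them is a
  clique containing \<open>B\<close>, and maximality applies. If they coincide, \<open>B\<close> is
  a singleton.\<close>

lemma maximal_clique_eq_interval:
  assumes B: "is_maximal_clique {1..n} E B" and "B \<noteq> {}"
  shows "B = {Min B..Max B}"
proof -
  have fin: "finite B"
    using B finite_B by simp
  show ?thesis
  proof (cases "Min B < Max B")
    case True
    have "{Min B, Max B} \<subseteq> B" "card {Min B, Max B} = 2"
      using fin \<open>B \<noteq> {}\<close> True by simp_all
    then have "{Min B, Max B} \<in> E"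
      using B unfolding is_maximal_clique_def is_clique_def by blast
    then have "is_clique {1..n} E {Min B..Max B}"
      using True by (rule interval_clique[rotated])
    moreover have "B \<subseteq> {Min B..Max B}"
      using fin by auto
    ultimately show ?thesis
      using B unfolding is_maximal_clique_def by blast
  next
    case False
    have "B \<subseteq> {Min B..Max B}"
      using fin by auto
    moreover have "Max B = Min B"
      using False Min_le[OF fin Max_in[OF fin \<open>B \<noteq> {}\<close>]] by simp
    ultimately have "B \<subseteq> {Min B}"
      by simp
    then show ?thesis
      using \<open>B \<noteq> {}\<close> \<open>Max B = Min B\<close> by (auto simp: subset_singleton_iff)
  qed
qed

text \<open>
  List the vertices in increasing order, each repeated according to its multiplicity, and select
  every \<open>k\<close>-th entry. Two selected entries are \<open>k\<close> apart, so an edge between them would span a clique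
  of weight more than \<open>k\<close>; and the \<open>k\<close> consecutive entries in a clique of weight \<open>k\<close> include a
  selected one.
\<close>

lemma stable_set_peel:
  assumes p: "p \<in> H" and k: "0 < snd p"
  obtains F r where "F \<subseteq> {1..n}" "\<And>v w. v \<in> F \<Longrightarrow> w \<in> F \<Longrightarrow> v < w \<Longrightarrow> {v, w} \<notin> E"
    "r \<in> H" "p = (vec F (\<lambda>_. 1), 1) + r"
proof -
  define k where "k = snd p"
  define a where "a = Poly_Mapping.lookup (fst p)"
  \<comment> \<open>Vertex \<open>v\<close> occupies the positions from \<open>s v\<close> up to but
    excluding \<open>s (Suc v)\<close>, counted from zero. \<open>F\<close> collects the vertices
    holding a position that is a multiple of \<open>k\<close>.\<close>
  define s where "s v = (\<Sum>j<v. a j)" for v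
  define F where "F = {v \<in> {1..n}. \<exists>m. s v \<le> m * k \<and> m * k < s (Suc v)}"
  have "k > 0"
    using k by (simp add: k_def)
  have s_Suc: "s (Suc v) = s v + a v" for v
    by (simp add: s_def)
  have s_mono: "s v \<le> s w" if "v \<le> w" for v w
    unfolding s_def by (rule sum_mono2) (use that in auto)
  have s_interval: "s v + sum a {v..w} = s (Suc w)" if "v \<le> w" for v w
  proof -
    have "sum a {0..<v} + sum a {v..<Suc w} = sum a {0..<Suc w}"
      by (rule sum.atLeastLessThan_concat) (use that in auto)
    then show ?thesis
      by (simp only: s_def atLeast0LessThan lessThan_Suc_atMost atLeast0AtMost
          atLeastLessThanSuc_atLeastAtMost)
  qed
  have keys: "Poly_Mapping.keys (fst p) \<subseteq> {1..n}"
    using p by (simp add: clique_semigroup_def)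
  have max_le: "sum a B \<le> k" if "is_maximal_clique {1..n} E B" for B
    using p that by (simp add: clique_semigroup_def a_def k_def)
  have clique_le: "sum a C \<le> k" if "is_clique {1..n} E C" for C
  proof -
    obtain B where B: "is_maximal_clique {1..n} E B" "C \<subseteq> B"
      using clique_extends_to_maximal[OF finite_V \<open>is_clique {1..n} E C\<close>] by blast
    have "sum a C \<le> sum a B"
      by (rule sum_mono2) (use B finite_B in auto)
    then show ?thesis
      using max_le[OF B(1)] by simp
  qed
  have sub: "F \<subseteq> {1..n}"
    by (auto simp: F_def)
  have finF: "finite F"
    using sub finite_subset by blast
  have stable: "{v, w} \<notin> E" if v: "v \<in> F" and w: "w \<in> F" and "v < w" for v w
  proof
    assume "{v, w} \<in> E"
    then have "sum a {v..w} \<le> k"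
      using clique_le interval_clique[OF \<open>v < w\<close>] by blast
    obtain m where m: "s v \<le> m * k" "m * k < s (Suc v)"
      using v by (auto simp: F_def)
    obtain m' where m': "s w \<le> m' * k" "m' * k < s (Suc w)"
      using w by (auto simp: F_def)
    \<comment> \<open>The block of \<open>v\<close> ends no later than the block of \<open>w\<close>
      begins, so the two multiples are distinct.\<close>
    have "m * k < m' * k"
      using m(2) s_mono[of "Suc v" w] m'(1) \<open>v < w\<close> by linarith
    then have "Suc m \<le> m'"
      by simp
    then have "Suc m * k \<le> m' * k"
      by (rule mult_le_mono1)
    then have "s v + k < s (Suc w)"
      using m(1) m'(2) by simp
    then show False
      using s_interval[of v w] \<open>v < w\<close> \<open>sum a {v..w} \<le> k\<close> by simp
  qed
  have tight: "B \<inter> F \<noteq> {}" if B: "is_maximal_clique {1..n} E B" and "sum a B = k" for B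
  proof -
    have "B \<noteq> {}"
      using that \<open>k > 0\<close> by auto
    define v where "v = Min B"
    define w where "w = Max B"
    have B_eq: "B = {v..w}"
      unfolding v_def w_def by (rule maximal_clique_eq_interval[OF B \<open>B \<noteq> {}\<close>])
    then have "v \<le> w"
      using \<open>B \<noteq> {}\<close> by auto
    then have s: "s (Suc w) = s v + k"
      using s_interval[of v w] \<open>sum a B = k\<close> by (simp add: B_eq)
    \<comment> \<open>This is \<open>s v / k\<close> rounded up: the first multiple of
      \<open>k\<close> from \<open>s v\<close> on, which lies before \<open>s v + k\<close>.\<close>
    define m where "m = (s v + k - 1) div k"
    have "m * k + (s v + k - 1) mod k = s v + k - 1"
      by (simp add: m_def)
    moreover have "(s v + k - 1) mod k < k"
      using \<open>k > 0\<close> by simp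
    ultimately have "s v \<le> m * k" "m * k < s (Suc w)"
      using \<open>k > 0\<close> unfolding s by linarith+
    then obtain j where "j \<in> {v..w}" "s j \<le> m * k" "m * k < s (Suc j)"
      using prefix_sum_hit \<open>v \<le> w\<close> by blast
    moreover have "B \<subseteq> {1..n}"
      using subset_V B by simp
    ultimately have "j \<in> B \<inter> F"
      unfolding F_def B_eq by blast
    then show ?thesis
      by blast
  qed
  define b where "b = vec F (\<lambda>_. 1)"
  have b: "Poly_Mapping.lookup b v = (if v \<in> F then 1 else 0)" for v
    using finF by (simp add: b_def lookup_vec)
  \<comment> \<open>A selected vertex has a nonempty block of positions, hence multiplicity at least
    one.\<close>
  have b_le: "Poly_Mapping.lookup b v \<le> a v" for v
    unfolding b using s_Suc[of v] by (auto simp: F_def)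
  define r where "r = (fst p - b, k - 1)"
  have "fst p = b + (fst p - b)"
    by (rule poly_mapping_eqI) (use b_le in \<open>simp add: lookup_add lookup_minus a_def\<close>)
  then have eq: "p = (vec F (\<lambda>_. 1), 1) + r"
    using \<open>k > 0\<close> by (simp add: r_def b_def k_def prod_eq_iff)
  \<comment> \<open>A clique of weight below \<open>k\<close> already satisfies the bound for degree
    \<open>k - 1\<close>; one of weight \<open>k\<close> loses at least one by
    \<open>tight\<close>.\<close>
  have "(\<Sum>i\<in>B. Poly_Mapping.lookup (fst r) i) \<le> snd r" if B: "is_maximal_clique {1..n} E B" for B
  proof -
    have "finite B"
      using B finite_B by simp
    have "(\<Sum>i\<in>B. Poly_Mapping.lookup (fst r) i) + (\<Sum>i\<in>B. Poly_Mapping.lookup b i) = sum a B"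
      unfolding sum.distrib[symmetric]
      by (rule sum.cong) (use b_le in \<open>auto simp: r_def lookup_minus a_def\<close>)
    moreover have "(\<Sum>i\<in>B. Poly_Mapping.lookup b i) = card (B \<inter> F)"
      using \<open>finite B\<close> by (simp add: b sum.If_cases)
    moreover have "0 < card (B \<inter> F)" if "sum a B = k"
      using tight[OF B that] \<open>finite B\<close> by (simp add: card_gt_0_iff)
    ultimately show ?thesis
      using max_le[OF B] \<open>k > 0\<close> unfolding r_def snd_conv by linarith
  qed
  moreover have "Poly_Mapping.keys (fst r) \<subseteq> {1..n}"
    using keys by (auto simp: r_def in_keys_iff lookup_minus)
  ultimately have "r \<in> H"
    by (simp add: clique_semigroup_def)
  with sub stable eq show ?thesis
    using that by blast
qed

text \<open>A clique and a stable set share at most one vertex.\<close>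

lemma stable_set_mem:
  assumes "F \<subseteq> {1..n}" "\<And>v w. v \<in> F \<Longrightarrow> w \<in> F \<Longrightarrow> v < w \<Longrightarrow> {v, w} \<notin> E"
  shows "(vec F (\<lambda>_. 1), 1) \<in> H"
proof -
  have fin: "finite F"
    using assms(1) finite_subset by blast
  have "(\<Sum>i\<in>B. Poly_Mapping.lookup (vec F (\<lambda>_. 1)) i) \<le> 1"
    if B: "is_maximal_clique {1..n} E B" for B
  proof -
    have edge: "{v, w} \<in> E" if "v \<in> B" "w \<in> B" "v \<noteq> w" for v w
    proof -
      have "{v, w} \<subseteq> B \<and> card {v, w} = 2"
        using that by simp
      then show ?thesis
        using B unfolding is_maximal_clique_def is_clique_def by blast
    qed
    have "\<not> v < w" if "v \<in> B \<inter> F" "w \<in> B \<inter> F" for v w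
      using that edge[of v w] assms(2)[of v w] by auto
    then have "\<forall>v\<in>B \<inter> F. \<forall>w\<in>B \<inter> F. v = w"
      by (meson linorder_neqE_nat)
    then have "card (B \<inter> F) \<le> 1"
      using card_le_Suc0_iff_eq[of "B \<inter> F"] fin by simp
    then show ?thesis
      using fin B finite_B by (simp add: lookup_vec sum.If_cases)
  qed
  then show ?thesis
    using keys_vec_subset[OF fin, of "\<lambda>_. 1"] assms(1) by (auto simp: clique_semigroup_def)
qed

end

section \<open>Comparison with the toric ring\<close>

lemma is_subalgebra_Inter: "Ball T is_subalgebra \<Longrightarrow> is_subalgebra (\<Inter>T)"
  unfolding is_subalgebra_def by blast

lemma constant_eq_mterm: "[:Poly_Mapping.single 0 c:] = mterm 0 c"
  by (simp add: mterm_def monom_0)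

lemma unit_interval_complex_graph:
  assumes "unit_interval_complex n D"
  shows "unit_interval_graph n (facets D)"
  using assms by unfold_locales (auto simp: unit_interval_complex_def)

text \<open>Facets are two-element sets, so the independence complex consists of the stable sets of
  the graph.\<close>

lemma Ind_iff:
  assumes "unit_interval_complex n D"
  shows "F \<in> Ind n D \<longleftrightarrow> F \<subseteq> {1..n} \<and> (\<forall>v\<in>F. \<forall>w\<in>F. v < w \<longrightarrow> {v, w} \<notin> facets D)"
proof
  assume "F \<in> Ind n D"
  then show "F \<subseteq> {1..n} \<and> (\<forall>v\<in>F. \<forall>w\<in>F. v < w \<longrightarrow> {v, w} \<notin> facets D)"
    by (auto simp: Ind_def)
next
  assume F: "F \<subseteq> {1..n} \<and> (\<forall>v\<in>F. \<forall>w\<in>F. v < w \<longrightarrow> {v, w} \<notin> facets D)"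
  have "\<not> G \<subseteq> F" if G: "G \<in> facets D" for G
  proof
    assume "G \<subseteq> F"
    have "card G = 2"
      using assms G by (simp add: unit_interval_complex_def)
    then obtain v w where "G = {v, w}" "v \<noteq> w"
      by (auto simp: card_2_iff)
    then obtain v w where "G = {v, w}" "v < w"
      by (metis insert_commute linorder_neqE_nat)
    with F G \<open>G \<subseteq> F\<close> show False
      by blast
  qed
  with F show "F \<in> Ind n D"
    by (simp add: Ind_def)
qed

text \<open>The generators have exponents in \<open>H\<close>, which is closed under addition.
  Conversely, induction on the t-degree writes each monomial with exponent in \<open>H\<close> as a
  product of generators, splitting off one stable set at a time.\<close>

lemma toric_ring_eq:
  assumes D: "unit_interval_complex n D"
  shows "(toric_ring (Ind n D) :: 'k::field mpol poly ring) =
    semigroup_ring (clique_semigroup {1..n} {B. is_maximal_clique {1..n} (facets D) B})"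
proof -
  interpret unit_interval_graph n "facets D"
    by (rule unit_interval_complex_graph[OF D])
  let ?G = "{Polynomial.monom (xset F) 1 | F. F \<in> Ind n D} :: 'k mpol poly set"
  have finF: "finite F" if "F \<in> Ind n D" for F
    using that finite_subset by (auto simp: Ind_def)
  have "is_subalgebra hull ?G = supported H"
  proof (rule antisym)
    show "is_subalgebra hull ?G \<subseteq> supported H"
    proof (rule hull_minimal)
      show "?G \<subseteq> supported H"
      proof
        fix f assume "f \<in> ?G"
        then obtain F where F: "F \<in> Ind n D" "f = Polynomial.monom (xset F) 1"
          by blast
        then have "(vec F (\<lambda>_. 1), 1) \<in> H"
          by (intro stable_set_mem) (auto simp: Ind_iff[OF D])
        then show "f \<in> supported H"
          unfolding F(2) monom_xset[OF finF[OF F(1)]] mterm_supported by blast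
      qed
      show "is_subalgebra (supported H :: 'k mpol poly set)"
        unfolding is_subalgebra_def constant_eq_mterm
      proof (intro conjI allI ballI)
        show "mterm 0 c \<in> supported H" for c :: 'k
          unfolding mterm_supported using zero_mem by blast
        show "f + g \<in> supported H" "f * g \<in> supported H"
          if "f \<in> supported H" "g \<in> supported H" for f g :: "'k mpol poly"
          using that supported_mult[OF that add_mem] by blast+
      qed
    qed
    let ?A = "is_subalgebra hull ?G"
    have A: "is_subalgebra ?A"
      by (rule hull_in) (rule is_subalgebra_Inter)
    have "p \<in> H \<Longrightarrow> mterm p 1 \<in> ?A" for p
    proof (induction "snd p" arbitrary: p)
      \<comment> \<open>In degree zero the monomial is a constant, and every subalgebra contains the
        constants.\<close>
      case 0
      have "mterm p (1 :: 'k) \<in> supported H"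
        unfolding mterm_supported using 0 by blast
      moreover have "Polynomial.degree (mterm p (1 :: 'k)) = 0"
        using 0 by (simp add: mterm_def monom_0)
      ultimately obtain c :: 'k where "mterm p 1 = mterm 0 c"
        using constant_mterm by blast
      then show ?case
        using A unfolding is_subalgebra_def constant_eq_mterm by simp
    next
      case (Suc k)
      obtain F r where F: "F \<subseteq> {1..n}" "\<And>v w. v \<in> F \<Longrightarrow> w \<in> F \<Longrightarrow> v < w \<Longrightarrow> {v, w} \<notin> facets D"
        and r: "r \<in> H" "p = (vec F (\<lambda>_. 1), 1) + r"
        using stable_set_peel[OF Suc.prems] Suc.hyps(2) by (metis zero_less_Suc)
      have "F \<in> Ind n D"
        using F by (simp add: Ind_iff[OF D])
      then have "mterm (vec F (\<lambda>_. 1), 1) 1 \<in> ?A"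
        unfolding monom_xset[OF finF[OF \<open>F \<in> Ind n D\<close>], symmetric]
        by (intro hull_inc) blast
      moreover have "mterm r 1 \<in> ?A"
        using Suc.hyps r by simp
      ultimately have "mterm (vec F (\<lambda>_. 1), 1) 1 * mterm r 1 \<in> ?A"
        using A unfolding is_subalgebra_def by blast
      then show ?case
        by (simp add: mterm_mult r(2))
    qed
    then have scaled: "mterm p c \<in> ?A" if "p \<in> H" for p c
    proof -
      have "mterm 0 c * mterm p 1 \<in> ?A"
        using A that \<open>\<And>p. p \<in> H \<Longrightarrow> mterm p 1 \<in> ?A\<close>
        unfolding is_subalgebra_def constant_eq_mterm by blast
      then show ?thesis
        by (simp add: mterm_mult)
    qed
    show "supported H \<subseteq> ?A"
    proof
      fix f :: "'k mpol poly" assume "f \<in> supported H"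
      then show "f \<in> ?A"
      proof (induction rule: supported_induct)
        case zero
        show ?case
          using scaled[OF zero_mem, of 0] by (simp add: mterm_def)
      next
        case (add f g)
        then show ?case
          using A unfolding is_subalgebra_def by blast
      qed (rule scaled)
    qed
  qed
  then show ?thesis
    by (simp add: toric_ring_def semigroup_ring_def)
qed

theorem corollary2p3:
  fixes n :: nat and \<Delta> \<Gamma> :: "nat set set" and R :: "'k::field mpol poly ring"
  assumes "unit_interval_complex n \<Delta>"
    and "\<Gamma> = Ind n \<Delta>"
    and "R = toric_ring \<Gamma>"
  shows "a_invariant R = - int (Max {card B + 1 | B. is_maximal_clique {1..n} (facets \<Delta>) B})
    \<and> (gorenstein R \<longleftrightarrow> unmixed {1..n} (complement_edges {1..n} (facets \<Delta>)))
    \<and> (gorenstein R \<longrightarrow>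
         canonical_ideal R =
           Idl\<^bsub>R\<^esub> {Polynomial.monom (xset {1..n}) (clique_number {1..n} (facets \<Delta>) + 1)})"
proof -
  interpret unit_interval_graph n "facets \<Delta>"
    by (rule unit_interval_complex_graph[OF assms(1)])
  have R: "R = semigroup_ring H"
    using assms toric_ring_eq by metis
  let ?C = "{B. is_maximal_clique {1..n} (facets \<Delta>) B}"
  have "Max {card B + 1 | B. is_maximal_clique {1..n} (facets \<Delta>) B} = Max (Suc ` card ` ?C)"
    by (rule arg_cong[of _ _ Max]) auto
  \<comment> \<open>\<open>Suc\<close> is monotone, so it commutes with the maximum of a finite
    nonempty set.\<close>
  also have "\<dots> = Suc (Max (card ` ?C))"
    using finite_C nonempty by (intro mono_Max_commute[symmetric]) (auto simp: mono_def)
  finally have "a_invariant R = - int (Max {card B + 1 | B. is_maximal_clique {1..n} (facets \<Delta>) B})"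
    unfolding R a_invariant_R max_size_def by simp
  \<comment> \<open>Since \<open>max_size\<close> is attained, sizes agree pairwise exactly when all
    equal \<open>max_size\<close>.\<close>
  moreover have "gorenstein R \<longleftrightarrow> unmixed {1..n} (complement_edges {1..n} (facets \<Delta>))"
    unfolding R gorenstein_iff unmixed_complement_edges_iff[OF finite_V]
    using max_size_attained by (metis mem_Collect_eq)
  moreover have "canonical_ideal R =
      Idl\<^bsub>R\<^esub> {Polynomial.monom (xset {1..n}) (clique_number {1..n} (facets \<Delta>) + 1)}" if "gorenstein R"
    using gorenstein_imp_principal that
    unfolding R monom_xset[OF finite_V] clique_number_eq_Max[OF finite_V] all_ones_def max_size_def .
  ultimately show ?thesis
    by blast
qed

end
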